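(* Let $\alpha<0$ and $\lambda>0$ be fixed, let $f$, $s_0$ and $L_1(C)$ be as in the context, and assume $f''>0$. If $L_1(C)$ is decreasing for $C>s_0$, then for given $L>0$ the problem $$u''+\lambda f(u)=0\ \text{ in }(0,L),\qquad u'(0)=\alpha u(0),\quad u'(L)=-\alpha u(L)$$ has at most two monotone increasing solutions, and at most two monotone decreasing solutions.
   Context: $f\in C^2(\mathbb{R})$ satisfies $f>0$, $f'\ge 0$ on $\mathbb{R}$, $\lim_{u\to\infty}f(u)/u=\infty$, and $f$ is integrable at $-\infty$. Set $F(u)=\int_{-\infty}^u f(t)\,dt$, $F^{-1}:(0,\infty)\to\mathbb{R}$, $s_0=F(0)$, $\gamma^*=\sqrt{\lambda}/\alpha<0$. For $C>0$ let $\mathcal{K}_C=\{(v,F^{-1}(C-v^2/2)): v^2<2C\}$ in the $(v,u)$-plane and $\mathcal{L}^\pm=\{(v,\pm\gamma^*v):v\in\mathbb{R}\}$. For $C>s_0$, $\mathcal{L}^+$ meets $\mathcal{K}_C$ in exactly two points $P_i^+=(v_i^+,u_i^+)$, $i=1,2$, with $v_1^+>v_2^+$, and $\mathcal{L}^-$ meets $\mathcal{K}_C$ in the reflected points $P_i^-=(-v_i^+,u_i^+)$. With $v=u'/\sqrt\lambda$, the monotone increasing (decreasing) solutions considered are those represented by the arc $\widehat{P_1^+P_2^-}$ (respectively $\widehat{P_2^+P_1^-}$) of $\mathcal{K}_C$ with $C>s_0$, traversed as $x$ runs from $0$ to $L$. For $C>s_0$, $$L_1(C)=2\int_0^{v_1^+}\frac{dv}{\sqrt{\lambda}\,f\left(F^{-1}\left(C-\frac{v^2}{2}\right)\right)},\qquad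 v_1^+=v_1^+(C).$$ *)

theory Defs
  imports "HOL-Analysis.Analysis"
begin

definition F :: "(real \<Rightarrow> real) \<Rightarrow> real \<Rightarrow> real" where
  "F f u = integral {..u} f"

text \<open>Only the values on the range of \<^term>\<open>F f\<close> are meaningful; under the standing
  assumptions on \<open>f\<close> this range is the open half-line of positive reals and \<^term>\<open>F f\<close> is injective.\<close>
definition Finv :: "(real \<Rightarrow> real) \<Rightarrow> real \<Rightarrow> real" where
  "Finv f = inv (F f)"

definition s0 :: "(real \<Rightarrow> real) \<Rightarrow> real" where
  "s0 f = F f 0"

definition gamma_star :: "real \<Rightarrow> real \<Rightarrow> real" where
  "gamma_star \<alpha> lam = sqrt lam / \<alpha>"

text \<open>Points of the phase plane are pairs \<open>(v, u)\<close>, in this order, with \<open>v = u' / sqrt lam\<close>.\<close>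
definition K :: "(real \<Rightarrow> real) \<Rightarrow> real \<Rightarrow> (real \<times> real) set" where
  "K f C = {(v, Finv f (C - v\<^sup>2 / 2)) | v. v\<^sup>2 < 2 * C}"

definition Lplus :: "real \<Rightarrow> real \<Rightarrow> (real \<times> real) set" where
  "Lplus \<alpha> lam = {(v, gamma_star \<alpha> lam * v) | v. True}"

definition Lminus :: "real \<Rightarrow> real \<Rightarrow> (real \<times> real) set" where
  "Lminus \<alpha> lam = {(v, - gamma_star \<alpha> lam * v) | v. True}"

text \<open>For \<open>C > s0 f\<close> the line \<^term>\<open>Lplus \<alpha> lam\<close> meets \<^term>\<open>K f C\<close> in exactly two points, so the
  maximum and the minimum below are the two abscissae, the larger one having index 1.\<close>
definition v1 :: "(real \<Rightarrow> real) \<Rightarrow> real \<Rightarrow> real \<Rightarrow> real \<Rightarrow> real" where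
  "v1 f \<alpha> lam C = Max (fst ` (K f C \<inter> Lplus \<alpha> lam))"

definition v2 :: "(real \<Rightarrow> real) \<Rightarrow> real \<Rightarrow> real \<Rightarrow> real \<Rightarrow> real" where
  "v2 f \<alpha> lam C = Min (fst ` (K f C \<inter> Lplus \<alpha> lam))"

definition P1plus :: "(real \<Rightarrow> real) \<Rightarrow> real \<Rightarrow> real \<Rightarrow> real \<Rightarrow> real \<times> real" where
  "P1plus f \<alpha> lam C = (v1 f \<alpha> lam C, gamma_star \<alpha> lam * v1 f \<alpha> lam C)"

definition P2plus :: "(real \<Rightarrow> real) \<Rightarrow> real \<Rightarrow> real \<Rightarrow> real \<Rightarrow> real \<times> real" where
  "P2plus f \<alpha> lam C = (v2 f \<alpha> lam C, gamma_star \<alpha> lam * v2 f \<alpha> lam C)"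

text \<open>The points of \<^term>\<open>K f C \<inter> Lminus \<alpha> lam\<close>: reflections of the previous two in the \<open>u\<close>-axis.\<close>
definition P1minus :: "(real \<Rightarrow> real) \<Rightarrow> real \<Rightarrow> real \<Rightarrow> real \<Rightarrow> real \<times> real" where
  "P1minus f \<alpha> lam C = (- v1 f \<alpha> lam C, gamma_star \<alpha> lam * v1 f \<alpha> lam C)"

definition P2minus :: "(real \<Rightarrow> real) \<Rightarrow> real \<Rightarrow> real \<Rightarrow> real \<Rightarrow> real \<times> real" where
  "P2minus f \<alpha> lam C = (- v2 f \<alpha> lam C, gamma_star \<alpha> lam * v2 f \<alpha> lam C)"

definition L1 :: "(real \<Rightarrow> real) \<Rightarrow> real \<Rightarrow> real \<Rightarrow> real \<Rightarrow> real" where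
  "L1 f \<alpha> lam C =
     2 * integral {0..v1 f \<alpha> lam C} (\<lambda>v. 1 / (sqrt lam * f (Finv f (C - v\<^sup>2 / 2))))"

text \<open>\<^term>\<open>K f C\<close> is a graph over the \<open>v\<close>-axis, so the arc between two of its points
  consists of the points whose abscissa lies between theirs.\<close>
definition arc_of_K :: "(real \<Rightarrow> real) \<Rightarrow> real \<Rightarrow> real \<times> real \<Rightarrow> real \<times> real \<Rightarrow> (real \<times> real) set" where
  "arc_of_K f C P Q = {p \<in> K f C. fst p \<in> closed_segment (fst P) (fst Q)}"

text \<open>Classical solution: \<open>u\<close> is continuously differentiable on \<open>[0, L]\<close> with derivative \<open>u'\<close>
  (one-sided at the end points) and satisfies the equation in the open interval.\<close>
definition bvp_solution ::
  "(real \<Rightarrow> real) \<Rightarrow> real \<Rightarrow> real \<Rightarrow> real \<Rightarrow> (real \<Rightarrow> real) \<Rightarrow> (real \<Rightarrow> real) \<Rightarrow> bool" where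
  "bvp_solution f \<alpha> lam L u u' \<longleftrightarrow>
     (\<forall>x\<in>{0..L}. (u has_real_derivative u' x) (at x within {0..L})) \<and>
     continuous_on {0..L} u' \<and>
     (\<forall>x\<in>{0<..<L}. \<exists>w. (u' has_real_derivative w) (at x) \<and> w + lam * f (u x) = 0) \<and>
     u' 0 = \<alpha> * u 0 \<and> u' L = - \<alpha> * u L"

definition phase :: "real \<Rightarrow> (real \<Rightarrow> real) \<Rightarrow> (real \<Rightarrow> real) \<Rightarrow> real \<Rightarrow> real \<times> real" where
  "phase lam u u' x = (u' x / sqrt lam, u x)"

definition traverses_arc ::
  "(real \<Rightarrow> real) \<Rightarrow> real \<Rightarrow> real \<times> real \<Rightarrow> real \<times> real \<Rightarrow> real \<Rightarrow> (real \<Rightarrow> real \<times> real) \<Rightarrow> bool" where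
  "traverses_arc f C P Q L g \<longleftrightarrow> g 0 = P \<and> g L = Q \<and> g ` {0..L} = arc_of_K f C P Q"

definition increasing_solution ::
  "(real \<Rightarrow> real) \<Rightarrow> real \<Rightarrow> real \<Rightarrow> real \<Rightarrow> (real \<Rightarrow> real) \<Rightarrow> bool" where
  "increasing_solution f \<alpha> lam L u \<longleftrightarrow> mono_on {0..L} u \<and>
     (\<exists>u'. bvp_solution f \<alpha> lam L u u' \<and>
       (\<exists>C > s0 f. traverses_arc f C (P1plus f \<alpha> lam C) (P2minus f \<alpha> lam C) L (phase lam u u')))"

definition decreasing_solution ::
  "(real \<Rightarrow> real) \<Rightarrow> real \<Rightarrow> real \<Rightarrow> real \<Rightarrow> (real \<Rightarrow> real) \<Rightarrow> bool" where
  "decreasing_solution f \<alpha> lam L u \<longleftrightarrow> antimono_on {0..L} u \<and>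
     (\<exists>u'. bvp_solution f \<alpha> lam L u u' \<and>
       (\<exists>C > s0 f. traverses_arc f C (P2plus f \<alpha> lam C) (P1minus f \<alpha> lam C) L (phase lam u u')))"

text \<open>Solutions are functions on \<open>[0, L]\<close>, so they are counted as elements of
  \<^term>\<open>extensional {0..L}\<close>; otherwise values off the interval would produce spurious copies.\<close>
definition increasing_solutions ::
  "(real \<Rightarrow> real) \<Rightarrow> real \<Rightarrow> real \<Rightarrow> real \<Rightarrow> (real \<Rightarrow> real) set" where
  "increasing_solutions f \<alpha> lam L = {u \<in> extensional {0..L}. increasing_solution f \<alpha> lam L u}"

definition decreasing_solutions ::
  "(real \<Rightarrow> real) \<Rightarrow> real \<Rightarrow> real \<Rightarrow> real \<Rightarrow> (real \<Rightarrow> real) set" where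
  "decreasing_solutions f \<alpha> lam L = {u \<in> extensional {0..L}. decreasing_solution f \<alpha> lam L u}"

end

theory Submission
  imports Defs
begin

text \<open>
  Along a solution the point \<open>(v, u)\<close> with \<open>v = u' / sqrt lam\<close> stays on an energy level
  \<open>F(u) + v^2/2 = C\<close> and moves with \<open>v' = - sqrt lam * f(u)\<close>. Put \<open>b = - gamma_star\<close>, and let \<open>n\<close> and \<open>w\<close>
  be the positive numbers \<open>v\<close> at which the lines \<open>u = - b v\<close> and \<open>u = b v\<close> meet the level. A solution at
  level \<open>C\<close> then satisfies \<open>T(C) = sqrt lam * L\<close>, where the transit time \<open>T(C)\<close> is the integral of
  \<open>1 / f(F^-1(C - v^2/2))\<close> over \<open>w \<le> v \<le> n\<close>; by symmetry in \<open>v\<close> it is the same for increasing and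
  decreasing solutions. The level determines the solution (\<open>trajectory_unique\<close>). So it is enough
  that \<open>T\<close> is injective, and in fact \<open>T\<close> is strictly decreasing (\<open>transit_time_strict_decreasing\<close>): each
  class contains at most one solution.

  The monotonicity of \<open>L1\<close> concerns a longer arc, from \<open>v = n\<close> down to \<open>v = 0\<close>, at every level. The
  information at the single level \<open>C\<close> does not by itself control \<open>T'(C)\<close>; the information at all lower levels
  does. Split the arcs at height \<open>u = 0\<close>, where \<open>v = V\<close> with \<open>V^2 = 2 (C - F(0))\<close>. In the upper part use
  the angle \<open>t\<close> with \<open>v = V cos t\<close> and \<open>2 (F(u) - F(0)) = (V sin t)^2\<close>. Then \<open>V\<close> times the derivative in \<open>V\<close>
  of the time from \<open>u = 0\<close> to \<open>v = 0\<close> is the integral of one function \<open>period_density\<close> of \<open>V sin t\<close> over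
  the quarter circle, and \<open>T\<close> involves only the sector \<open>0 \<le> t \<le> p\<close> of that circle, where
  \<open>cos p = w / V\<close>. An Abel inversion (\<open>abel_identity\<close>) expresses the integral over the sector, with weight
  \<open>1 - cos p * cos t\<close>, as a positive average of the quarter-circle integrals for the radii
  \<open>V sin p sin a\<close>. The monotonicity of \<open>L1\<close> bounds each of these integrals by the rate at which the time
  spent in the lower part \<open>u < 0\<close> decreases. The terms not accounted for by the weighted integral, namely
  the correction of the weight and the motion of the end point \<open>w\<close>, add up to a negative multiple of a square.

  The average closes because of a growth law for the lower part: the decay rate of the time
  spent there, multiplied by \<open>V^5\<close>, is strictly increasing in \<open>C\<close> (\<open>scaled_defect_strict_mono\<close>), which
  matches the power of the radius in the Abel kernel exactly (\<open>abel_bound\<close>). The growth law is proved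
  by comparison with a constant force \<open>f(- b n)\<close>, for which it becomes an inequality between
  rational functions (\<open>constant_force_inequality\<close>).
\<close>

section \<open>Integrals over a circle and an Abel inversion\<close>

lemma FTC_real:
  fixes f :: "real \<Rightarrow> real"
  assumes "a \<le> b" and "\<And>x. x \<in> {a..b} \<Longrightarrow> (f has_real_derivative f' x) (at x within {a..b})"
  shows "(f' has_integral (f b - f a)) {a..b}"
  using assms by (intro fundamental_theorem_of_calculus) (auto simp: has_real_derivative_iff_has_vector_derivative)

definition wallis_integral :: "nat \<Rightarrow> real" where
  "wallis_integral n = integral {0..pi/2} (\<lambda>t. sin t ^ n)"

lemma DERIV_sin_power:
  "((\<lambda>t. sin t ^ (n+1)) has_real_derivative real (n+1) * sin x ^ n * cos x) (at x within S)"
  by (rule derivative_eq_intros refl | simp)+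

text \<open>The reduction formula is kept for a general upper limit: at \<open>pi/2\<close> it is the Wallis recursion,
  and at \<open>p\<close> it drives the other side of the Abel identity.\<close>

lemma integral_sin_power_rec:
  assumes "0 \<le> p"
  shows "real (n + 2) * integral {0..p} (\<lambda>t. sin t ^ (n+2))
       = real (n + 1) * integral {0..p} (\<lambda>t. sin t ^ n) - cos p * sin p ^ (n+1)"
proof -
  have "((\<lambda>t. real (n+2) * sin t ^ (n+2) - real (n+1) * sin t ^ n) has_integral
         (- cos p * sin p ^ (n+1)) - (- cos 0 * sin 0 ^ (n+1))) {0..p}"
  proof (rule FTC_real[OF assms])
    fix x assume "x \<in> {0..p}"
    have e: "sin x ^ (n+2) = (1 - (cos x)\<^sup>2) * sin x ^ n"
    proof -
      have "sin x ^ (n+2) = (sin x)\<^sup>2 * sin x ^ n" by (simp add: power2_eq_square)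
      then show ?thesis by (simp only: sin_squared_eq)
    qed
    then have e2: "sin x * sin x ^ (n+1) = (1 - (cos x)\<^sup>2) * sin x ^ n" by simp
    have "((\<lambda>t. - cos t) has_real_derivative sin x) (at x within {0..p})"
      by (auto intro!: derivative_eq_intros)
    from DERIV_mult[OF this DERIV_sin_power[of n]]
    show "((\<lambda>t. - cos t * sin t ^ (n+1)) has_real_derivative
        real (n+2) * sin x ^ (n+2) - real (n+1) * sin x ^ n) (at x within {0..p})"
    proof (rule DERIV_cong)
      show "sin x * sin x ^ (n+1) + real (n+1) * sin x ^ n * cos x * - cos x
          = real (n+2) * sin x ^ (n+2) - real (n+1) * sin x ^ n"
        unfolding e e2 by (simp add: algebra_simps power2_eq_square)
    qed
  qed
  then have "integral {0..p} (\<lambda>t. real (n+2) * sin t ^ (n+2) - real (n+1) * sin t ^ n)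
      = - cos p * sin p ^ (n+1)"
    by (simp add: integral_unique)
  moreover have "integral {0..p} (\<lambda>t. real (n+2) * sin t ^ (n+2) - real (n+1) * sin t ^ n)
     = real (n+2) * integral {0..p} (\<lambda>t. sin t ^ (n+2)) - real (n+1) * integral {0..p} (\<lambda>t. sin t ^ n)"
    by (subst integral_diff)
      (auto intro!: integrable_continuous_real continuous_intros)
  ultimately show ?thesis by simp
qed

lemma wallis_integral_rec:
  "real (n + 2) * wallis_integral (n + 2) = real (n + 1) * wallis_integral n"
  using integral_sin_power_rec[of "pi/2" n] by (simp add: wallis_integral_def)

lemma wallis_integral_0: "wallis_integral 0 = pi / 2"
  by (simp add: wallis_integral_def)

lemma wallis_integral_1: "wallis_integral 1 = 1"
proof -
  have "(sin has_integral (- cos (pi/2)) - (- cos 0)) {0..pi/2}"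
    by (rule FTC_real) (auto intro!: derivative_eq_intros)
  then show ?thesis by (simp add: wallis_integral_def integral_unique)
qed

lemma wallis_integral_product:
  "real (n + 1) * (wallis_integral n * wallis_integral (n + 1)) = pi / 2"
proof (induction n)
  case 0
  then show ?case by (simp add: wallis_integral_0 wallis_integral_1[simplified])
next
  case (Suc n)
  have "real (Suc n + 1) * (wallis_integral (Suc n) * wallis_integral (Suc n + 1))
     = wallis_integral (n+1) * (real (n + 2) * wallis_integral (n+2))"
    by simp
  also have "\<dots> = wallis_integral (n+1) * (real (n + 1) * wallis_integral n)"
    by (simp only: wallis_integral_rec)
  also have "\<dots> = pi / 2" using Suc.IH by (simp add: mult_ac)
  finally show ?case .
qed

definition sin_kernel_integral :: "real \<Rightarrow> nat \<Rightarrow> real" where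
  "sin_kernel_integral s n = integral {0..pi/2} (\<lambda>t. sin t ^ n / (1 - s\<^sup>2 * (sin t)\<^sup>2))"

lemma sin_kernel_pos:
  fixes s t :: real
  assumes "0 < s" "s < 1"
  shows "1 - s\<^sup>2 * (sin t)\<^sup>2 > 0"
proof -
  have "s\<^sup>2 < 1" using assms by (simp add: power_less_one_iff)
  moreover have "s\<^sup>2 * (sin t)\<^sup>2 \<le> s\<^sup>2 * 1"
    by (rule mult_left_mono) (auto simp: abs_square_le_1)
  ultimately show ?thesis by linarith
qed

text \<open>Replace \<open>s^2 sin^2\<close> in the numerator by \<open>1 - (1 - s^2 sin^2)\<close>.\<close>

lemma sin_kernel_integral_rec:
  assumes "0 < s" "s < 1"
  shows "s\<^sup>2 * sin_kernel_integral s (n + 2) = sin_kernel_integral s n - wallis_integral n"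
proof -
  have ne: "1 - s\<^sup>2 * (sin t)\<^sup>2 \<noteq> 0" for t using sin_kernel_pos[OF assms, of t] by simp
  have eq: "s\<^sup>2 * (sin t ^ (n+2) / (1 - s\<^sup>2 * (sin t)\<^sup>2))
      = sin t ^ n / (1 - s\<^sup>2 * (sin t)\<^sup>2) - sin t ^ n" for t
    using ne[of t] by (simp add: field_simps power_add power2_eq_square)
  have "s\<^sup>2 * sin_kernel_integral s (n + 2)
      = integral {0..pi/2} (\<lambda>t. s\<^sup>2 * (sin t ^ (n+2) / (1 - s\<^sup>2 * (sin t)\<^sup>2)))"
    unfolding sin_kernel_integral_def by (rule integral_mult_right[symmetric])
  also have "\<dots> = integral {0..pi/2} (\<lambda>t. sin t ^ n / (1 - s\<^sup>2 * (sin t)\<^sup>2) - sin t ^ n)"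
    by (simp only: eq)
  also have "\<dots> = sin_kernel_integral s n - wallis_integral n"
    unfolding sin_kernel_integral_def wallis_integral_def
    by (subst integral_diff) (auto intro!: integrable_continuous_real continuous_intros simp: ne[simplified])
  finally show ?thesis .
qed

text \<open>The substitution \<open>x = cos t\<close> turns the integrand into \<open>1 / (cos^2 p + sin^2 p * x^2)\<close>.\<close>

lemma sin_kernel_integral_1:
  assumes "0 < p" "p < pi/2"
  shows "sin_kernel_integral (sin p) 1 = p / (sin p * cos p)"
proof -
  have s: "0 < sin p" "0 < cos p"
    using assms by (auto intro: sin_gt_zero cos_gt_zero)
  let ?g = "\<lambda>t. - (1 / (sin p * cos p)) * arctan (sin p * cos t / cos p)"
  have "((\<lambda>t. sin t / (1 - (sin p)\<^sup>2 * (sin t)\<^sup>2)) has_integral ?g (pi/2) - ?g 0) {0..pi/2}"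
  proof (rule FTC_real)
    fix x :: real assume "x \<in> {0..pi/2}"
    have e: "1 - (sin p)\<^sup>2 * (sin x)\<^sup>2 = (cos p)\<^sup>2 + (sin p)\<^sup>2 * (cos x)\<^sup>2"
      by (simp add: cos_squared_eq algebra_simps)
    have pos: "(cos p)\<^sup>2 + (sin p)\<^sup>2 * (cos x)\<^sup>2 > 0"
      using s by (intro add_pos_nonneg) auto
    have "(?g has_real_derivative - (1 / (sin p * cos p)) *
        (inverse (1 + (sin p * cos x / cos p)\<^sup>2) * (sin p * (- sin x) / cos p))) (at x within {0..pi/2})"
      using s by (auto intro!: derivative_eq_intros simp: divide_simps)
    moreover have "- (1 / (sin p * cos p)) *
        (inverse (1 + (sin p * cos x / cos p)\<^sup>2) * (sin p * (- sin x) / cos p))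
       = sin x / (1 - (sin p)\<^sup>2 * (sin x)\<^sup>2)"
      unfolding e using s pos by (simp add: divide_simps power2_eq_square)
    ultimately show "(?g has_real_derivative sin x / (1 - (sin p)\<^sup>2 * (sin x)\<^sup>2)) (at x within {0..pi/2})"
      by simp
  qed (simp add: pi_ge_zero)
  moreover have "arctan (sin p / cos p) = p"
    using assms by (metis arctan_tan less_trans minus_less_iff neg_less_0_iff_less pi_half_gt_zero tan_def)
  ultimately show ?thesis
    by (simp add: sin_kernel_integral_def integral_unique)
qed

text \<open>This is the Abel identity for \<open>y(z) = z^(2k)\<close>. The powers of \<open>sin\<close> separate, and both sides obey
  the same two-step recursion in the exponent, so only the exponent 0 needs an explicit integral. That is why
  even powers are used; they suffice for approximating a continuous function on \<open>[0, 1]\<close>.\<close>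

lemma abel_identity_even_power:
  assumes p: "0 < p" "p < pi/2"
  shows "2 / pi * cos p * sin p ^ (2*k+3) * (wallis_integral (2*k) * sin_kernel_integral (sin p) (2*k+3))
     = integral {0..p} (\<lambda>t. sin t ^ (2*k) * (1 - cos p * cos t))"
proof -
  have s: "0 < sin p" "0 < cos p" "sin p < 1"
    using p sin_monotone_2pi[of p "pi/2"] by (auto intro: sin_gt_zero cos_gt_zero)
  define S where "S = (\<lambda>n. integral {0..p} (\<lambda>t. sin t ^ n))"
  have R: "integral {0..p} (\<lambda>t. sin t ^ n * (1 - cos p * cos t)) = S n - cos p * sin p ^ (n+1) / real (n+1)" for n
  proof -
    have "((\<lambda>t. sin t ^ n * cos t) has_integral sin p ^ (n+1) / real (n+1) - sin 0 ^ (n+1) / real (n+1)) {0..p}"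
    proof (rule FTC_real)
      fix x
      show "((\<lambda>t. sin t ^ (n+1) / real (n+1)) has_real_derivative sin x ^ n * cos x) (at x within {0..p})"
        by (rule derivative_eq_intros refl | simp add: field_simps del: of_nat_Suc)+
    qed (use p in simp)
    then have "integral {0..p} (\<lambda>t. sin t ^ n * cos t) = sin p ^ (n+1) / real (n+1)"
      by (simp add: integral_unique)
    moreover have "integral {0..p} (\<lambda>t. sin t ^ n * (1 - cos p * cos t))
        = S n - cos p * integral {0..p} (\<lambda>t. sin t ^ n * cos t)"
      unfolding S_def integral_mult_right[symmetric]
      by (subst integral_diff[symmetric])
        (auto intro!: integrable_continuous_real continuous_intros integral_cong simp: algebra_simps)
    ultimately show ?thesis by simp
  qed
  define Q where "Q = (\<lambda>n. 2 / pi * cos p * sin p ^ (n+3) * (wallis_integral n * sin_kernel_integral (sin p) (n+3)))"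
  have main: "Q (2*k) = S (2*k) - cos p * sin p ^ (2*k+1) / real (2*k+1)"
  proof (induction k)
    case 0
    have "(sin p)\<^sup>2 * sin_kernel_integral (sin p) 3 = p / (sin p * cos p) - 1"
      using sin_kernel_integral_rec[OF s(1,3), of 1] sin_kernel_integral_1[OF p] wallis_integral_1
      by (simp add: numeral_3_eq_3)
    then have "cos p * sin p * ((sin p)\<^sup>2 * sin_kernel_integral (sin p) 3) = p - cos p * sin p"
      using s by (simp add: field_simps)
    moreover have "S 0 = p" using p by (simp add: S_def)
    ultimately show ?case
      by (simp add: Q_def wallis_integral_0 power2_eq_square power3_eq_cube mult_ac)
  next
    case (Suc k)
    define n where "n = 2*k"
    have n2: "2 * Suc k = n + 2" by (simp add: n_def)
    have w: "wallis_integral (n+2) = real (n+1) / real (n+2) * wallis_integral n"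
      using wallis_integral_rec[of n] by (simp add: field_simps)
    have w2: "wallis_integral (n+2) * wallis_integral (n+3) = pi / 2 / real (n+3)"
      using wallis_integral_product[of "n+2"] by (simp add: field_simps numeral_3_eq_3)
    have "Q (n+2) = 2 / pi * cos p * sin p ^ (n+3) * (wallis_integral (n+2) *
        ((sin p)\<^sup>2 * sin_kernel_integral (sin p) (n+3+2)))"
      by (simp add: Q_def power_add power2_eq_square mult_ac add_ac eval_nat_numeral)
    also have "\<dots> = 2 / pi * cos p * sin p ^ (n+3) * (wallis_integral (n+2) *
        (sin_kernel_integral (sin p) (n+3) - wallis_integral (n+3)))"
      by (simp only: sin_kernel_integral_rec[OF s(1,3)])
    also have "\<dots> = 2 / pi * cos p * sin p ^ (n+3) * (wallis_integral (n+2) * sin_kernel_integral (sin p) (n+3))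
        - 2 / pi * cos p * sin p ^ (n+3) * (wallis_integral (n+2) * wallis_integral (n+3))"
      by (simp add: algebra_simps)
    also have "\<dots> = real (n+1) / real (n+2) * Q n - cos p * sin p ^ (n+3) / real (n+3)"
    proof -
      have "2 / pi * cos p * sin p ^ (n+3) * (pi / 2 / real (n+3)) = cos p * sin p ^ (n+3) / real (n+3)"
        by (simp add: divide_simps) 
      then show ?thesis unfolding w2 unfolding w Q_def by (simp only: ac_simps times_divide_eq_left times_divide_eq_right divide_divide_eq_left)
    qed
    also have "Q n = S n - cos p * sin p ^ (n+1) / real (n+1)"
      using Suc.IH by (simp add: n_def)
    also have "real (n+1) / real (n+2) * (S n - cos p * sin p ^ (n+1) / real (n+1))
        = (real (n+1) * S n - cos p * sin p ^ (n+1)) / real (n+2)"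
    proof -
      have *: "a / b * (u - x / a) = (a * u - x) / b" if "a \<noteq> 0" for a b u x :: real
        using that by (simp add: right_diff_distrib diff_divide_distrib)
      show ?thesis by (rule *) simp
    qed
    also have "\<dots> = S (n+2)"
      using integral_sin_power_rec[of p n] p by (simp add: S_def field_simps)
    finally show ?case unfolding n2 by (simp add: numeral_3_eq_3)
  qed
  then show ?thesis by (simp add: Q_def R)
qed

lemma abs_integral_le:
  fixes g :: "real \<Rightarrow> real"
  assumes "a \<le> b" "continuous_on {a..b} g" "\<And>x. x \<in> {a..b} \<Longrightarrow> \<bar>g x\<bar> \<le> B"
  shows "\<bar>integral {a..b} g\<bar> \<le> B * (b - a)"
  using integral_bound[of a b g B] assms by auto

text \<open>In terms of the radius \<open>x = sin p * sin a\<close> the weight is the Abel kernel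
  \<open>x^3 / ((1 - x^2) sqrt (sin^2 p - x^2))\<close> up to a constant factor, since \<open>dx = sin p cos a da\<close>; the angle \<open>a\<close> removes the
  singularity at the largest radius.\<close>

definition abel_weight :: "real \<Rightarrow> real \<Rightarrow> real" where
  "abel_weight p a = 2 / pi * cos p * sin p ^ 3 * (sin a ^ 3 / (1 - (sin p)\<^sup>2 * (sin a)\<^sup>2))"

definition quarter_circle_integral :: "(real \<Rightarrow> real) \<Rightarrow> real \<Rightarrow> real" where
  "quarter_circle_integral y r = integral {0..pi/2} (\<lambda>t. y (r * sin t))"

lemma sin_unit: "t \<in> {0..pi/2} \<Longrightarrow> sin t \<in> {0..1::real}"
  by (auto intro!: sin_ge_zero)

lemma continuous_on_quarter_circle_integral:
  assumes y: "continuous_on {0..1} y"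
  shows "continuous_on {0..1} (quarter_circle_integral y)"
proof -
  have "continuous_on ({0..1} \<times> cbox 0 (pi/2)) (\<lambda>(r, t). y (r * sin t))"
    unfolding split_beta
    by (rule continuous_on_compose2[OF y])
      (auto intro!: continuous_intros mult_nonneg_nonneg mult_le_one sin_ge_zero)
  from integral_continuous_on_param[OF this] show ?thesis
    by (simp add: quarter_circle_integral_def)
qed

text \<open>Abel inversion: an integral over the sector \<open>0 \<le> t \<le> p\<close> of the unit circle is an average of
  quarter-circle integrals of smaller radius. Both sides are continuous in \<open>y\<close> for uniform convergence on
  \<open>[0, 1]\<close>, and they agree on even polynomials, which are dense by the Weierstrass theorem applied to
  \<open>y (sqrt x)\<close>.\<close>

lemma abel_identity:
  assumes p: "0 < p" "p < pi/2" and y: "continuous_on {0..1} y"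
  shows "integral {0..pi/2} (\<lambda>a. abel_weight p a * quarter_circle_integral y (sin p * sin a))
       = integral {0..p} (\<lambda>t. y (sin t) * (1 - cos p * cos t))"
proof -
  have s: "0 < sin p" "0 < cos p" "sin p < 1"
    using p sin_monotone_2pi[of p "pi/2"] by (auto intro: sin_gt_zero cos_gt_zero)
  have ne: "(sin p)\<^sup>2 * (sin t)\<^sup>2 \<noteq> 1" for t using sin_kernel_pos[OF s(1,3), of t] by simp
  have cw: "continuous_on {0..pi/2} (abel_weight p)"
    unfolding abel_weight_def by (auto intro!: continuous_intros simp: ne)
  have sub: "sin p * sin a \<in> {0..1}" if "a \<in> {0..pi/2}" for a
    using sin_unit[OF that] s by (auto intro: mult_le_one)
  have sub': "sin t \<in> {0..1}" if "t \<in> {0..p}" for t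
    using sin_unit[of t] that p by auto
  define L where "L = (\<lambda>y. integral {0..pi/2} (\<lambda>a. abel_weight p a * quarter_circle_integral y (sin p * sin a)))"
  define R where "R = (\<lambda>y. integral {0..p} (\<lambda>t. y (sin t) * (1 - cos p * cos t)))"
  have cL: "continuous_on {0..pi/2} (\<lambda>a. quarter_circle_integral y (sin p * sin a))" if "continuous_on {0..1} y" for y
    by (rule continuous_on_compose2[OF continuous_on_quarter_circle_integral[OF that]])
      (use sub in \<open>auto intro!: continuous_intros\<close>)
  have cM: "continuous_on {0..pi/2} (\<lambda>t. y (r * sin t))" if "continuous_on {0..1} y" "r \<in> {0..1}" for y r
    by (rule continuous_on_compose2[OF that(1)])
      (use that(2) sin_unit in \<open>auto intro!: continuous_intros mult_nonneg_nonneg mult_le_one sin_ge_zero\<close>)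
  have cR: "continuous_on {0..p} (\<lambda>t. y (sin t))" if "continuous_on {0..1} y" for y
    by (rule continuous_on_compose2[OF that]) (use sub' in \<open>auto intro!: continuous_intros\<close>)
  have mean_lin: "quarter_circle_integral (\<lambda>x. u x + c * v x) r = quarter_circle_integral u r + c * quarter_circle_integral v r"
    if "continuous_on {0..1} u" "continuous_on {0..1} v" "r \<in> {0..1}" for u v c r
    unfolding quarter_circle_integral_def integral_mult_right[symmetric]
    by (intro integral_add integrable_continuous_real continuous_intros cM that)
  have L_lin: "L (\<lambda>x. u x + c * v x) = L u + c * L v"
    if "continuous_on {0..1} u" "continuous_on {0..1} v" for u v c
  proof -
    have "L (\<lambda>x. u x + c * v x) = integral {0..pi/2} (\<lambda>a. abel_weight p a * quarter_circle_integral u (sin p * sin a)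
            + c * (abel_weight p a * quarter_circle_integral v (sin p * sin a)))"
      unfolding L_def
    proof (rule integral_cong)
      fix a :: real assume "a \<in> {0..pi/2}"
      then show "abel_weight p a * quarter_circle_integral (\<lambda>x. u x + c * v x) (sin p * sin a)
          = abel_weight p a * quarter_circle_integral u (sin p * sin a)
            + c * (abel_weight p a * quarter_circle_integral v (sin p * sin a))"
        by (simp only: mean_lin[OF that sub]) (simp only: distrib_left mult.left_commute)
    qed
    also have "\<dots> = L u + c * L v"
      unfolding L_def integral_mult_right[symmetric]
      by (intro integral_add integrable_continuous_real continuous_intros cL cw that)
    finally show ?thesis .
  qed
  have R_lin: "R (\<lambda>x. u x + c * v x) = R u + c * R v"
    if "continuous_on {0..1} u" "continuous_on {0..1} v" for u v c
  proof -
    have "R (\<lambda>x. u x + c * v x) = integral {0..p} (\<lambda>t. u (sin t) * (1 - cos p * cos t)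
            + c * (v (sin t) * (1 - cos p * cos t)))"
      unfolding R_def by (rule integral_cong) (simp add: algebra_simps)
    also have "\<dots> = R u + c * R v"
      unfolding R_def integral_mult_right[symmetric]
      by (intro integral_add integrable_continuous_real continuous_intros cR that)
    finally show ?thesis .
  qed
  have mono: "L (\<lambda>x. x ^ (2*k)) = R (\<lambda>x. x ^ (2*k))" for k
  proof -
    have eq: "abel_weight p a * quarter_circle_integral (\<lambda>x. x ^ (2*k)) (sin p * sin a)
        = (2 / pi * cos p * sin p ^ (2*k+3) * wallis_integral (2*k))
          * (sin a ^ (2*k+3) / (1 - (sin p)\<^sup>2 * (sin a)\<^sup>2))" for a
    proof -
      have "quarter_circle_integral (\<lambda>x. x ^ (2*k)) (sin p * sin a) = (sin p * sin a) ^ (2*k) * wallis_integral (2*k)"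
        unfolding quarter_circle_integral_def wallis_integral_def
        by (subst power_mult_distrib) (rule integral_mult_right)
      then show ?thesis by (simp add: abel_weight_def power_add power_mult_distrib)
    qed
    have "L (\<lambda>x. x ^ (2*k)) = integral {0..pi/2} (\<lambda>a. (2 / pi * cos p * sin p ^ (2*k+3) * wallis_integral (2*k))
       * (sin a ^ (2*k+3) / (1 - (sin p)\<^sup>2 * (sin a)\<^sup>2)))"
      unfolding L_def eq ..
    also have "\<dots> = R (\<lambda>x. x ^ (2*k))"
      unfolding integral_mult_right sin_kernel_integral_def[symmetric] R_def
      using abel_identity_even_power[OF p, of k] by (simp add: mult_ac)
    finally show ?thesis .
  qed
  have poly: "L (\<lambda>x. \<Sum>i\<le>n. c i * x ^ (2*i)) = R (\<lambda>x. \<Sum>i\<le>n. c i * x ^ (2*i))" for c :: "nat \<Rightarrow> real" and n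
  proof (induction n)
    case 0
    have "L (\<lambda>x. 0 + c 0 * x ^ (2*0)) = R (\<lambda>x. 0 + c 0 * x ^ (2*0))"
      by (subst L_lin R_lin; (intro continuous_intros)?)+
        (simp only: mono, simp add: L_def R_def quarter_circle_integral_def)
    then show ?case by simp
  next
    case (Suc n)
    have "L (\<lambda>x. (\<Sum>i\<le>n. c i * x ^ (2*i)) + c (Suc n) * x ^ (2 * Suc n))
        = R (\<lambda>x. (\<Sum>i\<le>n. c i * x ^ (2*i)) + c (Suc n) * x ^ (2 * Suc n))"
      by (subst L_lin R_lin; (intro continuous_intros)?)+ (simp only: mono Suc.IH)
    then show ?case by (simp only: sum.atMost_Suc)
  qed
  obtain B where B: "\<And>a. a \<in> {0..pi/2} \<Longrightarrow> \<bar>abel_weight p a\<bar> \<le> B" "B \<ge> 0"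
  proof -
    have "bounded (abel_weight p ` {0..pi/2})"
      by (intro compact_imp_bounded compact_continuous_image cw) auto
    then obtain B where "\<forall>a\<in>{0..pi/2}. \<bar>abel_weight p a\<bar> \<le> B"
      by (auto simp: bounded_iff)
    then show ?thesis by (intro that[of "max B 0"]) (auto simp: le_max_iff_disj)
  qed
  \<comment> \<open>The difference of the two functionals is at most \<open>M\<close> times the sup norm.\<close>
  define M where "M = B * (pi/2) * (pi/2) + 2 * p"
  have M: "M \<ge> 0" using B p by (simp add: M_def)
  have small: "\<bar>L u - R u\<bar> \<le> M * e" if u: "continuous_on {0..1} u" and e: "\<And>x. x \<in> {0..1} \<Longrightarrow> \<bar>u x\<bar> \<le> e" for u e
  proof -
    have e0: "e \<ge> 0" using e[of 0] by simp
    have m: "\<bar>quarter_circle_integral u r\<bar> \<le> e * (pi/2)" if "r \<in> {0..1}" for r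
      unfolding quarter_circle_integral_def
      by (rule order_trans[OF abs_integral_le[where B=e]])
        (use that in \<open>auto intro!: cM[OF u] e mult_nonneg_nonneg mult_le_one sin_ge_zero\<close>)
    have "\<bar>L u\<bar> \<le> (B * (e * (pi/2))) * (pi/2 - 0)"
      unfolding L_def
    proof (rule abs_integral_le)
      show "continuous_on {0..pi/2} (\<lambda>a. abel_weight p a * quarter_circle_integral u (sin p * sin a))"
        by (intro continuous_intros cw cL u)
      fix a assume "a \<in> {0..pi/2}"
      then show "\<bar>abel_weight p a * quarter_circle_integral u (sin p * sin a)\<bar> \<le> B * (e * (pi/2))"
        unfolding abs_mult using B m[OF sub] by (intro mult_mono) auto
    qed simp
    moreover have "\<bar>R u\<bar> \<le> (e * 2) * (p - 0)"
      unfolding R_def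
    proof (rule abs_integral_le)
      show "continuous_on {0..p} (\<lambda>t. u (sin t) * (1 - cos p * cos t))"
        by (intro continuous_intros cR u)
      fix t assume t: "t \<in> {0..p}"
      have "\<bar>cos p * cos t\<bar> \<le> 1" unfolding abs_mult by (rule mult_le_one) auto
      then have "\<bar>1 - cos p * cos t\<bar> \<le> 2" by linarith
      then show "\<bar>u (sin t) * (1 - cos p * cos t)\<bar> \<le> e * 2"
        unfolding abs_mult using e[OF sub'[OF t]] e0 by (intro mult_mono) auto
    qed (use p in simp)
    ultimately show ?thesis by (simp add: M_def algebra_simps)
  qed
  have "\<bar>L y - R y\<bar> \<le> M * e" if e: "e > 0" for e
  proof -
    have "continuous_on {0..1} (\<lambda>x. y (sqrt x))"
      by (rule continuous_on_compose2[OF y]) (auto intro!: continuous_intros)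
    with e obtain g where g: "real_polynomial_function g" "\<And>x. x \<in> {0..1} \<Longrightarrow> \<bar>y (sqrt x) - g x\<bar> < e"
      using Stone_Weierstrass_real_polynomial_function[of "{0..1::real}" "\<lambda>x. y (sqrt x)" e] by auto
    then obtain c n where c: "g = (\<lambda>x. \<Sum>i\<le>n. c i * x ^ i)"
      using real_polynomial_function_iff_sum by auto
    define q where "q = (\<lambda>x::real. \<Sum>i\<le>n. c i * x ^ (2*i))"
    have q: "q x = g (x\<^sup>2)" for x by (simp add: q_def c power_mult)
    have cq: "continuous_on {0..1} q" unfolding q_def by (intro continuous_intros)
    have "\<bar>L (\<lambda>x. y x + (-1) * q x) - R (\<lambda>x. y x + (-1) * q x)\<bar> \<le> M * e"
    proof (rule small)
      show "continuous_on {0..1} (\<lambda>x. y x + (-1) * q x)" by (intro continuous_intros y cq)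
      fix x :: real assume x: "x \<in> {0..1}"
      then have "x\<^sup>2 \<in> {0..1}" by (auto simp: power_le_one)
      from g(2)[OF this] x show "\<bar>y x + (-1) * q x\<bar> \<le> e" by (simp add: q)
    qed
    moreover have "L q = R q" unfolding q_def by (rule poly)
    ultimately show ?thesis by (simp only: L_lin[OF y cq] R_lin[OF y cq])
  qed
  note this[of "e / (M + 1)" for e]
  have "\<bar>L y - R y\<bar> \<le> 0"
  proof (rule field_le_epsilon)
    fix e :: real assume "e > 0"
    then have "\<bar>L y - R y\<bar> \<le> M * (e / (M + 1))"
      using \<open>\<And>e. e / (M + 1) > 0 \<Longrightarrow> \<bar>L y - R y\<bar> \<le> M * (e / (M + 1))\<close>[of e] M by simp
    also have "\<dots> \<le> e" using M \<open>e > 0\<close> by (simp add: field_simps)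
    finally show "\<bar>L y - R y\<bar> \<le> 0 + e" by simp
  qed
  then show ?thesis by (simp add: L_def R_def)
qed

text \<open>The antiderivative \<open>arctan (cos p * tan t) / cos p\<close> is undefined at \<open>pi/2\<close>, so the bound is obtained on
  \<open>[0, x]\<close> with \<open>x < pi/2\<close> and passed to the limit.\<close>

lemma sin_kernel_integral_0_le:
  assumes "0 < p" "p < pi/2"
  shows "sin_kernel_integral (sin p) 0 \<le> pi / (2 * cos p)"
proof -
  have s: "0 < sin p" "0 < cos p" "sin p < 1"
    using assms sin_monotone_2pi[of p "pi/2"] by (auto intro: sin_gt_zero cos_gt_zero)
  have ne: "(sin p)\<^sup>2 * (sin t)\<^sup>2 \<noteq> 1" for t using sin_kernel_pos[OF s(1,3), of t] by simp
  let ?k = "\<lambda>t. 1 / (1 - (sin p)\<^sup>2 * (sin t)\<^sup>2)"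
  have c: "continuous_on {0..pi/2} ?k" by (auto intro!: continuous_intros simp: ne)
  have below: "integral {0..x} ?k \<le> pi / (2 * cos p)" if x: "0 \<le> x" "x < pi/2" for x
  proof -
    let ?g = "\<lambda>t. arctan (cos p * tan t) / cos p"
    have "(?k has_integral ?g x - ?g 0) {0..x}"
    proof (rule FTC_real[OF x(1)])
      fix t assume t: "t \<in> {0..x}"
      then have ct: "cos t > 0" using x by (intro cos_gt_zero_pi) auto
      have e: "1 - (sin p)\<^sup>2 * (sin t)\<^sup>2 = (cos t)\<^sup>2 + (cos p)\<^sup>2 * (sin t)\<^sup>2"
        by (simp add: cos_squared_eq algebra_simps)
      have pos: "(cos t)\<^sup>2 + (cos p)\<^sup>2 * (sin t)\<^sup>2 > 0"
        using ct by (intro add_pos_nonneg) auto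
      have "(?g has_real_derivative (inverse (1 + (cos p * tan t)\<^sup>2) * (cos p * inverse ((cos t)\<^sup>2))) / cos p) (at t within {0..x})"
        using ct s by (auto intro!: derivative_eq_intros)
      also have "(inverse (1 + (cos p * tan t)\<^sup>2) * (cos p * inverse ((cos t)\<^sup>2))) / cos p = ?k t"
        unfolding e using ct s pos by (simp add: divide_simps tan_def power2_eq_square)
      finally show "(?g has_real_derivative ?k t) (at t within {0..x})" .
    qed
    then have "integral {0..x} ?k = arctan (cos p * tan x) / cos p" by (simp add: integral_unique)
    also have "\<dots> \<le> (pi/2) / cos p"
      using s arctan_ubound[of "cos p * tan x"] by (intro divide_right_mono) auto
    finally show ?thesis by simp
  qed
  have lim: "((\<lambda>x. integral {0..x} ?k) \<longlongrightarrow> integral {0..pi/2} ?k) (at_left (pi/2))"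
    using indefinite_integral_continuous_1[OF integrable_continuous_real[OF c]]
    by (auto simp: continuous_on_def at_within_Icc_at_left dest!: bspec[where x="pi/2"])
  have "integral {0..pi/2} ?k \<le> pi / (2 * cos p)"
    by (rule tendsto_upperbound[OF lim])
      (auto simp: eventually_at_left[OF pi_half_gt_zero] intro!: exI[of _ 0] below)
  then show ?thesis by (simp add: sin_kernel_integral_def)
qed

text \<open>The weight \<open>abel_weight\<close> contains \<open>(sin p sin a)^3\<close>, so a bound of the quarter-circle integrals by a
  multiple of \<open>x^(-3)\<close> cancels this factor, and the weight that remains has total mass at most 1.\<close>

lemma abel_bound:
  assumes p: "0 < p" "p < pi/2" and y: "continuous_on {0..1} y"
    and le: "\<And>r. 0 < r \<Longrightarrow> r \<le> sin p \<Longrightarrow> quarter_circle_integral y r \<le> B / r ^ 3"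
  shows "integral {0..p} (\<lambda>t. y (sin t) * (1 - cos p * cos t)) \<le> B"
proof -
  have s: "0 < sin p" "0 < cos p" "sin p < 1"
    using p sin_monotone_2pi[of p "pi/2"] by (auto intro: sin_gt_zero cos_gt_zero)
  \<comment> \<open>The constant \<open>B\<close> cannot be negative, because the quarter-circle integrals stay bounded as the radius tends to 0.\<close>
  have "((\<lambda>r. r ^ 3 * quarter_circle_integral y r) \<longlongrightarrow> 0 ^ 3 * quarter_circle_integral y 0) (at 0 within {0..1})"
    using continuous_on_quarter_circle_integral[OF y] by (intro tendsto_intros) (auto simp: continuous_on_def)
  then have "((\<lambda>r. r ^ 3 * quarter_circle_integral y r) \<longlongrightarrow> 0) (at_right 0)"
    by (simp add: at_within_Icc_at_right)
  moreover have "\<forall>\<^sub>F r in at_right 0. r ^ 3 * quarter_circle_integral y r \<le> B"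
    unfolding eventually_at_right[OF s(1)]
    using le s by (intro exI[of _ "sin p"]) (auto simp: field_simps)
  ultimately have B: "0 \<le> B" by (rule tendsto_upperbound) simp
  have kp: "1 - (sin p)\<^sup>2 * (sin t)\<^sup>2 > 0" for t by (rule sin_kernel_pos[OF s(1,3)])
  have ne: "(sin p)\<^sup>2 * (sin t)\<^sup>2 \<noteq> 1" for t using kp[of t] by simp
  have sub: "sin p * sin a \<in> {0..1}" if "a \<in> {0..pi/2}" for a
    using sin_unit[OF that] s by (auto intro: mult_le_one)
  have "integral {0..p} (\<lambda>t. y (sin t) * (1 - cos p * cos t))
     = integral {0..pi/2} (\<lambda>a. abel_weight p a * quarter_circle_integral y (sin p * sin a))"
    by (rule abel_identity[OF p y, symmetric])
  also have "\<dots> \<le> integral {0..pi/2} (\<lambda>a. (2 / pi * cos p * B) * (sin a ^ 0 / (1 - (sin p)\<^sup>2 * (sin a)\<^sup>2)))"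
  proof (rule integral_le)
    show "(\<lambda>a. abel_weight p a * quarter_circle_integral y (sin p * sin a)) integrable_on {0..pi/2}"
    proof (intro integrable_continuous_real continuous_on_mult)
      show "continuous_on {0..pi/2} (abel_weight p)"
        unfolding abel_weight_def by (auto intro!: continuous_intros simp: ne)
      show "continuous_on {0..pi/2} (\<lambda>a. quarter_circle_integral y (sin p * sin a))"
        by (rule continuous_on_compose2[OF continuous_on_quarter_circle_integral[OF y]])
          (use sub in \<open>auto intro!: continuous_intros\<close>)
    qed
    show "(\<lambda>a. (2 / pi * cos p * B) * (sin a ^ 0 / (1 - (sin p)\<^sup>2 * (sin a)\<^sup>2))) integrable_on {0..pi/2}"
      by (intro integrable_continuous_real continuous_intros) (auto simp: ne)
    fix a assume a: "a \<in> {0..pi/2}"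
    show "abel_weight p a * quarter_circle_integral y (sin p * sin a)
        \<le> (2 / pi * cos p * B) * (sin a ^ 0 / (1 - (sin p)\<^sup>2 * (sin a)\<^sup>2))"
    proof (cases "sin a = 0")
      case True
      then show ?thesis using s B by (simp add: abel_weight_def)
    next
      case False
      then have sa: "sin a > 0" using sin_unit[OF a] by auto
      have "abel_weight p a * quarter_circle_integral y (sin p * sin a) \<le> abel_weight p a * (B / (sin p * sin a) ^ 3)"
      proof (rule mult_left_mono[OF le])
        show "sin p * sin a \<le> sin p" using s sa by simp
        show "0 \<le> abel_weight p a" unfolding abel_weight_def using s sa kp[of a] by simp
      qed (use s sa in simp)
      also have "\<dots> = (2 / pi * cos p * B) * (sin a ^ 0 / (1 - (sin p)\<^sup>2 * (sin a)\<^sup>2))"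
        unfolding abel_weight_def using s sa by (simp add: power_mult_distrib)
      finally show ?thesis .
    qed
  qed
  also have "\<dots> = 2 / pi * cos p * B * sin_kernel_integral (sin p) 0"
    unfolding integral_mult_right sin_kernel_integral_def ..
  also have "\<dots> \<le> 2 / pi * cos p * B * (pi / (2 * cos p))"
    by (rule mult_left_mono[OF sin_kernel_integral_0_le[OF p]]) (use s B in simp)
  also have "\<dots> = B" using s by simp
  finally show ?thesis .
qed

section \<open>Differentiating an integral with a moving end point\<close>

lemma integral_scale_real:
  fixes g :: "real \<Rightarrow> real"
  assumes "0 < c" "continuous_on {0..c} g"
  shows "integral {0..c} g = integral {0..1} (\<lambda>s. c * g (c * s))"
proof -
  have "((\<lambda>s. c *\<^sub>R g (c * s)) has_integral integral {c * 0..c * 1} g) {0..1}"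
    using assms by (intro has_integral_substitution[where c=0 and d=c])
      (auto intro!: derivative_eq_intros mult_left_le)
  then have "((\<lambda>s. c * g (c * s)) has_integral integral {0..c} g) {0..1}" by simp
  then show ?thesis by (rule integral_unique[symmetric])
qed

text \<open>The substitution \<open>p = c t * q\<close> moves the dependence on \<open>t\<close> into the integrand on the fixed interval
  \<open>[0, 1]\<close>. No values of \<open>g\<close> outside its domain \<open>(0, \<infinity>)\<close> are met, as they would be if the end point and the
  parameter were varied independently.\<close>

lemma DERIV_integral_moving_end:
  fixes g g' h h' c c' :: "real \<Rightarrow> real"
  assumes c: "\<And>t. s < t \<Longrightarrow> (c has_real_derivative c' t) (at t)" "continuous_on {s<..} c'"
    and cpos: "\<And>t. s < t \<Longrightarrow> 0 < c t"
    and g: "\<And>e. 0 < e \<Longrightarrow> (g has_real_derivative g' e) (at e)" "continuous_on {0<..} g'"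
    and h: "\<And>p. (h has_real_derivative h' p) (at p)" "continuous_on UNIV h'"
    and pos: "\<And>t p. s < t \<Longrightarrow> 0 \<le> p \<Longrightarrow> p \<le> c t \<Longrightarrow> h p < t"
    and t: "s < t"
  shows "((\<lambda>t. integral {0..c t} (\<lambda>p. g (t - h p))) has_real_derivative
      c' t * g (t - h (c t)) + integral {0..c t} (\<lambda>p. g' (t - h p))) (at t)"
proof -
  let ?G = "\<lambda>t q. c t * g (t - h (c t * q))"
  let ?G' = "\<lambda>t q. c' t * g (t - h (c t * q)) + c t * (g' (t - h (c t * q)) * (1 - h' (c t * q) * (c' t * q)))"
  have cont_c: "continuous_on {s<..} c"
    by (rule DERIV_continuous_on[where D=c']) (auto intro!: has_field_derivative_at_within[OF c(1)])
  have cont_g: "continuous_on {0<..} g"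
    by (rule DERIV_continuous_on[where D=g']) (auto intro!: has_field_derivative_at_within[OF g(1)])
  have cont_h: "continuous_on UNIV h"
    by (rule DERIV_continuous_on[where D=h']) (rule h(1))
  have arg: "0 < u - h (c u * q)" if "s < u" "q \<in> {0..1}" for u q
  proof -
    have "c u * q \<le> c u * 1" using that cpos[of u] by (intro mult_left_mono) auto
    then show ?thesis using pos[of u "c u * q"] that cpos[of u] by simp
  qed
  have dG: "((\<lambda>u. ?G u q) has_real_derivative ?G' u q) (at u within {s<..})"
    if "u \<in> {s<..}" "q \<in> cbox 0 1" for u q
  proof -
    have "((\<lambda>u. u - h (c u * q)) has_real_derivative 1 - h' (c u * q) * (c' u * q)) (at u)"
      using that by (intro derivative_intros DERIV_chain2[OF h(1)]) (auto intro!: derivative_eq_intros c(1))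
    from DERIV_mult[OF c(1) DERIV_chain2[OF g(1) this]]
    have "((\<lambda>u. ?G u q) has_real_derivative c' u * g (u - h (c u * q)) +
        g' (u - h (c u * q)) * (1 - h' (c u * q) * (c' u * q)) * c u) (at u)"
      using that arg by auto
    then show ?thesis
      by (rule DERIV_subset[OF DERIV_cong]) (auto simp: algebra_simps)
  qed
  have cG: "continuous_on ({s<..} \<times> {0..1}) (\<lambda>(u,q). g (u - h (c u * q)))"
    unfolding split_beta
    by (intro continuous_on_compose2[OF cont_g] continuous_intros
        continuous_on_compose2[OF cont_h] continuous_on_compose2[OF cont_c]) (auto intro: arg)
  have cG': "continuous_on ({s<..} \<times> {0..1}) (\<lambda>(u,q). ?G' u q)"
    unfolding split_beta
    by (intro continuous_on_compose2[OF cont_g] continuous_on_compose2[OF g(2)] continuous_intros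
        continuous_on_compose2[OF cont_h] continuous_on_compose2[OF cont_c]
        continuous_on_compose2[OF c(2)] continuous_on_compose2[OF h(2)]) (auto intro: arg)
  have cG1: "continuous_on {0..1} (?G u)" if "s < u" for u
    by (intro continuous_intros continuous_on_compose2[OF cont_g] continuous_on_compose2[OF cont_h])
      (auto intro: arg that)
  have "((\<lambda>u. integral (cbox 0 1) (?G u)) has_real_derivative integral (cbox 0 1) (?G' t)) (at t within {s<..})"
    using dG cG1 cG' t
    by (intro leibniz_rule_field_derivative) (auto intro!: integrable_continuous_real)
  then have D: "((\<lambda>u. integral {0..1} (?G u)) has_real_derivative integral {0..1} (?G' t)) (at t)"
    using t by (simp add: at_within_open[of t "{s<..}"])
  \<comment> \<open>The part of \<open>?G'\<close> that contains \<open>c' t\<close> is an exact derivative in \<open>q\<close>.\<close>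
  have "((\<lambda>q. ?G' t q - c t * g' (t - h (c t * q))) has_integral
      c' t * (1 * g (t - h (c t * 1))) - c' t * (0 * g (t - h (c t * 0)))) {0..1}"
  proof (rule FTC_real)
    fix q :: real assume q: "q \<in> {0..1}"
    have "((\<lambda>q. t - h (c t * q)) has_real_derivative - (h' (c t * q) * c t)) (at q within {0..1})"
      by (auto intro!: derivative_eq_intros DERIV_chain2[OF h(1)])
    from DERIV_chain2[OF g(1)[OF arg[OF t q]] this]
    have "((\<lambda>q. g (t - h (c t * q))) has_real_derivative g' (t - h (c t * q)) * (- (h' (c t * q) * c t)))
      (at q within {0..1})" .
    then show "((\<lambda>q. c' t * (q * g (t - h (c t * q)))) has_real_derivative
       ?G' t q - c t * g' (t - h (c t * q))) (at q within {0..1})"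
      by (auto intro!: derivative_eq_intros simp: algebra_simps)
  qed simp
  then have 1: "integral {0..1} (\<lambda>q. ?G' t q - c t * g' (t - h (c t * q))) = c' t * g (t - h (c t))"
    by (simp add: integral_unique)
  have i1: "continuous_on {0..1} (\<lambda>q. c t * g' (t - h (c t * q)))"
    by (intro continuous_intros continuous_on_compose2[OF g(2)] continuous_on_compose2[OF cont_h])
      (auto intro: arg t)
  have i2: "continuous_on {0..1} (?G' t)"
    by (intro continuous_on_compose2[OF cont_g] continuous_on_compose2[OF g(2)] continuous_intros
        continuous_on_compose2[OF cont_h] continuous_on_compose2[OF h(2)]) (auto intro: arg t)
  have "integral {0..1} (?G' t) = c' t * g (t - h (c t)) + integral {0..1} (\<lambda>q. c t * g' (t - h (c t * q)))"
    using 1 integral_diff[OF integrable_continuous_real[OF i2] integrable_continuous_real[OF i1]] by simp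
  also have "integral {0..1} (\<lambda>q. c t * g' (t - h (c t * q))) = integral {0..c t} (\<lambda>p. g' (t - h p))"
  proof (subst integral_scale_real[OF cpos[OF t]])
    show "continuous_on {0..c t} (\<lambda>p. g' (t - h p))"
      by (intro continuous_intros continuous_on_compose2[OF g(2)] continuous_on_compose2[OF cont_h])
        (use t in \<open>auto intro!: pos[of t]\<close>)
  qed simp
  finally have "((\<lambda>u. integral {0..1} (?G u)) has_real_derivative
      c' t * g (t - h (c t)) + integral {0..c t} (\<lambda>p. g' (t - h p))) (at t)"
    using D by simp
  then show ?thesis
  proof (rule has_field_derivative_transform_within_open)
    show "t \<in> {s<..}" using t by simp
    fix u assume u: "u \<in> {s<..}"
    have "continuous_on {0..c u} (\<lambda>p. g (u - h p))"
      by (intro continuous_intros continuous_on_compose2[OF cont_g] continuous_on_compose2[OF cont_h])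
        (use u in \<open>auto intro!: pos[of u]\<close>)
    then show "integral {0..1} (?G u) = integral {0..c u} (\<lambda>p. g (u - h p))"
      using u by (simp add: integral_scale_real cpos)
  qed simp
qed

section \<open>The inequality for a constant restoring force\<close>

text \<open>In terms of \<open>a = 1 / z\<close>: the function \<open>5 / z^3 - 3 X / z^5\<close> is decreasing in \<open>z\<close> as long as \<open>z^2 \<ge> X\<close>.\<close>

lemma cube_quint_antimono:
  fixes a c X :: real
  assumes "0 < c" "c \<le> a" "0 \<le> X" "X * a\<^sup>2 \<le> 1"
  shows "5 * c ^ 3 - 3 * X * c ^ 5 \<le> 5 * a ^ 3 - 3 * X * a ^ 5"
proof -
  have "0 \<le> (a - c)\<^sup>2 * (2 * a ^ 3 + 4 * a\<^sup>2 * c + 6 * a * c\<^sup>2 + 3 * c ^ 3)"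
    using assms by (intro mult_nonneg_nonneg add_nonneg_nonneg) auto
  also have "\<dots> = 5 * a\<^sup>2 * (a ^ 3 - c ^ 3) - 3 * (a ^ 5 - c ^ 5)"
    by (simp add: algebra_simps power2_eq_square power3_eq_cube eval_nat_numeral)
  finally have "X * (3 * (a ^ 5 - c ^ 5)) \<le> X * (5 * a\<^sup>2 * (a ^ 3 - c ^ 3))"
    using assms by (intro mult_left_mono) auto
  also have "\<dots> = (X * a\<^sup>2) * (5 * (a ^ 3 - c ^ 3))" by simp
  also have "\<dots> \<le> 1 * (5 * (a ^ 3 - c ^ 3))"
    using assms by (intro mult_right_mono) (auto intro: power_mono)
  finally show ?thesis by (simp add: algebra_simps)
qed

text \<open>The growth law for a constant force. Here \<open>n\<close> is the initial \<open>v\<close> and \<open>c\<close> the value of \<open>v\<close> which the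
  constant force would produce at height 0. The right-hand side is affine in \<open>X\<close>, so it is enough to look at
  \<open>X = 0\<close> and \<open>X = c^2\<close>; the latter case carries the factor \<open>n - c\<close>.\<close>

lemma constant_force_inequality:
  fixes c n X H :: real
  assumes c: "0 < c" "c < n" and X: "0 < X" "X \<le> c\<^sup>2"
    and H: "H = (n\<^sup>2 + c\<^sup>2) / 2"
  shows "0 \<le> 5 * (2 * n / (n\<^sup>2 - c\<^sup>2)) * (1 / c - 1 / n)
     - X * (2 * n / (n\<^sup>2 - c\<^sup>2)) * (1 / c ^ 3 - 1 / n ^ 3)
     - 5 / H + X * (1 / (n\<^sup>2 * H) + 1 / H\<^sup>2 + n\<^sup>2 / H ^ 3)" (is "0 \<le> ?E X")
proof -
  define M where "M = n\<^sup>2 + c\<^sup>2"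
  have n: "0 < n" using c by simp
  have M: "0 < M" "H = M / 2" using c n by (auto simp: M_def H intro!: add_pos_pos)
  have nc: "n\<^sup>2 - c\<^sup>2 = (n - c) * (n + c)" by (simp add: power2_eq_square algebra_simps)
  have e1: "2 * n / (n\<^sup>2 - c\<^sup>2) * (1 / c - 1 / n) = 2 / (c * (n + c))"
  proof -
    have "1 / c - 1 / n = (n - c) / (c * n)" using c n by (simp add: field_simps)
    then show ?thesis unfolding nc using c n by simp
  qed
  have e2: "2 * n / (n\<^sup>2 - c\<^sup>2) * (1 / c ^ 3 - 1 / n ^ 3) = 2 * (n\<^sup>2 + n * c + c\<^sup>2) / (c ^ 3 * n\<^sup>2 * (n + c))"
  proof -
    have "1 / c ^ 3 - 1 / n ^ 3 = (n - c) * (n\<^sup>2 + n * c + c\<^sup>2) / (c ^ 3 * n ^ 3)"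
      using c n by (simp add: field_simps power2_eq_square power3_eq_cube)
    then show ?thesis unfolding nc using c n by (simp add: power2_eq_square power3_eq_cube)
  qed
  have E: "?E x = 10 / (c * (n + c)) - 10 / M
      + x * (2 / (n\<^sup>2 * M) + 4 / M\<^sup>2 + 8 * n\<^sup>2 / M ^ 3 - 2 * (n\<^sup>2 + n * c + c\<^sup>2) / (c ^ 3 * n\<^sup>2 * (n + c)))" for x
  proof -
    have "5 * (2 * n / (n\<^sup>2 - c\<^sup>2)) * (1 / c - 1 / n) = 5 * (2 / (c * (n + c)))"
      using e1 by (simp only: mult.assoc)
    moreover have "x * (2 * n / (n\<^sup>2 - c\<^sup>2)) * (1 / c ^ 3 - 1 / n ^ 3)
        = x * (2 * (n\<^sup>2 + n * c + c\<^sup>2) / (c ^ 3 * n\<^sup>2 * (n + c)))"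
      using e2 by (simp only: mult.assoc)
    moreover have "x * (1 / (n\<^sup>2 * H) + 1 / H\<^sup>2 + n\<^sup>2 / H ^ 3) = x * (2 / (n\<^sup>2 * M) + 4 / M\<^sup>2 + 8 * n\<^sup>2 / M ^ 3)"
      unfolding M(2) by (simp add: power_divide)
    moreover have "5 / H = 10 / M" unfolding M(2) by simp
    ultimately show ?thesis by (simp add: right_diff_distrib)
  qed
  have E0: "0 \<le> ?E 0"
  proof -
    have "c * (n + c) \<le> M" using c n by (simp add: M_def power2_eq_square algebra_simps)
    then have "10 / M \<le> 10 / (c * (n + c))" using c n by (intro divide_left_mono) (auto intro: mult_pos_pos M)
    then show ?thesis unfolding E by simp
  qed
  have E1: "0 \<le> ?E (c\<^sup>2)"
  proof -
    have "0 \<le> 2 * n ^ 4 - n ^ 3 * c + 2 * n\<^sup>2 * c\<^sup>2 - n * c ^ 3 + 2 * c ^ 4"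
    proof -
      have "2 * n ^ 4 - n ^ 3 * c + 2 * n\<^sup>2 * c\<^sup>2 - n * c ^ 3 + 2 * c ^ 4
          = (n\<^sup>2 - n * c / 2)\<^sup>2 + (c\<^sup>2 - n * c / 2)\<^sup>2 + n ^ 4 + 3 / 2 * (n * c)\<^sup>2 + c ^ 4"
        by (simp add: power2_eq_square eval_nat_numeral algebra_simps)
      also have "\<dots> \<ge> 0" by simp
      finally show ?thesis .
    qed
    then have "0 \<le> 4 * n ^ 3 * (n - c) * (2 * n ^ 4 - n ^ 3 * c + 2 * n\<^sup>2 * c\<^sup>2 - n * c ^ 3 + 2 * c ^ 4)"
      using c n by (intro mult_nonneg_nonneg) auto
    also have "\<dots> = (8 * n\<^sup>2 - 2 * n * c - 2 * c\<^sup>2) * M ^ 3 - 10 * c * n\<^sup>2 * (n + c) * M\<^sup>2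
        + c ^ 3 * (n + c) * (2 * M\<^sup>2 + 4 * n\<^sup>2 * M + 8 * n ^ 4)" (is "_ = ?P")
      unfolding M_def by (simp add: algebra_simps power2_eq_square power3_eq_cube eval_nat_numeral)
    finally have "0 \<le> ?P / (c * n\<^sup>2 * (n + c) * M ^ 3)"
      using c n M by (intro divide_nonneg_pos mult_pos_pos) auto
    also have "?P / (c * n\<^sup>2 * (n + c) * M ^ 3) = ?E (c\<^sup>2)"
    proof -
      let ?D = "c * n\<^sup>2 * (n + c) * M ^ 3"
      have nz: "c \<noteq> 0" "n \<noteq> 0" "n + c \<noteq> 0" "M \<noteq> 0" using c n M by auto
      have cancel: "A / B = N / ?D" if "N = A * k" "?D = B * k" "k \<noteq> 0" for A B N k
        unfolding that(1,2) using that(3) by simp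
      have a1: "10 / (c * (n + c)) = 10 * n\<^sup>2 * M ^ 3 / ?D"
        by (rule cancel[of _ _ "n\<^sup>2 * M ^ 3"]) (use nz in \<open>auto simp: mult_ac\<close>)
      have a2: "10 / M = 10 * c * n\<^sup>2 * (n + c) * M\<^sup>2 / ?D"
        by (rule cancel[of _ _ "c * n\<^sup>2 * (n + c) * M\<^sup>2"])
          (use nz in \<open>auto simp: power2_eq_square power3_eq_cube\<close>)
      have "2 * c\<^sup>2 / (n\<^sup>2 * M) = c ^ 3 * (n + c) * (2 * M\<^sup>2) / ?D"
        by (rule cancel[of _ _ "c * (n + c) * M\<^sup>2"])
          (use nz in \<open>auto simp: power2_eq_square power3_eq_cube\<close>)
      then have a3: "c\<^sup>2 * (2 / (n\<^sup>2 * M)) = c ^ 3 * (n + c) * (2 * M\<^sup>2) / ?D" by (simp add: mult_ac)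
      have "4 * c\<^sup>2 / M\<^sup>2 = c ^ 3 * (n + c) * (4 * n\<^sup>2 * M) / ?D"
        by (rule cancel[of _ _ "c * n\<^sup>2 * (n + c) * M"])
          (use nz in \<open>auto simp: power2_eq_square power3_eq_cube\<close>)
      then have a4: "c\<^sup>2 * (4 / M\<^sup>2) = c ^ 3 * (n + c) * (4 * n\<^sup>2 * M) / ?D" by (simp add: mult_ac)
      have "8 * n\<^sup>2 * c\<^sup>2 / M ^ 3 = c ^ 3 * (n + c) * (8 * n ^ 4) / ?D"
        by (rule cancel[of _ _ "c * n\<^sup>2 * (n + c)"])
          (use nz in \<open>auto simp: power2_eq_square power3_eq_cube eval_nat_numeral\<close>)
      then have a5: "c\<^sup>2 * (8 * n\<^sup>2 / M ^ 3) = c ^ 3 * (n + c) * (8 * n ^ 4) / ?D" by (simp add: mult_ac)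
      have "(2 * n\<^sup>2 + 2 * n * c + 2 * c\<^sup>2) / (c * n\<^sup>2 * (n + c)) = (2 * n\<^sup>2 + 2 * n * c + 2 * c\<^sup>2) * M ^ 3 / ?D"
        by (rule cancel[of _ _ "M ^ 3"]) (use nz in auto)
      moreover have "c\<^sup>2 * (2 * (n\<^sup>2 + n * c + c\<^sup>2) / (c ^ 3 * n\<^sup>2 * (n + c)))
          = (2 * n\<^sup>2 + 2 * n * c + 2 * c\<^sup>2) / (c * n\<^sup>2 * (n + c))"
      proof -
        have "c\<^sup>2 * (2 * S / (c ^ 3 * n\<^sup>2 * (n + c))) = (2 * S) * c\<^sup>2 / ((c * n\<^sup>2 * (n + c)) * c\<^sup>2)" for S
          by (simp only: power2_eq_square power3_eq_cube mult_ac times_divide_eq_right)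
        also have "\<dots> S = 2 * S / (c * n\<^sup>2 * (n + c))" for S
          using nz by (subst mult_divide_mult_cancel_right) auto
        finally have *: "c\<^sup>2 * (2 * S / (c ^ 3 * n\<^sup>2 * (n + c))) = 2 * S / (c * n\<^sup>2 * (n + c))" for S .
        show ?thesis unfolding * by (simp only: distrib_left mult.assoc)
      qed
      ultimately have a6: "c\<^sup>2 * (2 * (n\<^sup>2 + n * c + c\<^sup>2) / (c ^ 3 * n\<^sup>2 * (n + c)))
          = (2 * n\<^sup>2 + 2 * n * c + 2 * c\<^sup>2) * M ^ 3 / ?D" by simp
      have "?E (c\<^sup>2) = 10 / (c * (n + c)) - 10 / M + c\<^sup>2 * (2 / (n\<^sup>2 * M)) + c\<^sup>2 * (4 / M\<^sup>2)
          + c\<^sup>2 * (8 * n\<^sup>2 / M ^ 3) - c\<^sup>2 * (2 * (n\<^sup>2 + n * c + c\<^sup>2) / (c ^ 3 * n\<^sup>2 * (n + c)))"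
        unfolding E by (simp add: algebra_simps)
      also have "\<dots> = (10 * n\<^sup>2 * M ^ 3 - 10 * c * n\<^sup>2 * (n + c) * M\<^sup>2 + c ^ 3 * (n + c) * (2 * M\<^sup>2)
         + c ^ 3 * (n + c) * (4 * n\<^sup>2 * M) + c ^ 3 * (n + c) * (8 * n ^ 4)
         - (2 * n\<^sup>2 + 2 * n * c + 2 * c\<^sup>2) * M ^ 3) / ?D"
        unfolding a1 a2 a3 a4 a5 a6 by (simp only: add_divide_distrib diff_divide_distrib)
      also have "10 * n\<^sup>2 * M ^ 3 - 10 * c * n\<^sup>2 * (n + c) * M\<^sup>2 + c ^ 3 * (n + c) * (2 * M\<^sup>2)
         + c ^ 3 * (n + c) * (4 * n\<^sup>2 * M) + c ^ 3 * (n + c) * (8 * n ^ 4)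
         - (2 * n\<^sup>2 + 2 * n * c + 2 * c\<^sup>2) * M ^ 3 = ?P"
        by (simp add: algebra_simps)
      finally show ?thesis by simp
    qed
    finally show ?thesis .
  qed
  define t where "t = X / c\<^sup>2"
  have t: "0 \<le> t" "t \<le> 1" "X = t * c\<^sup>2" using X c by (auto simp: t_def)
  have "?E X = (1 - t) * ?E 0 + t * ?E (c\<^sup>2)"
  proof -
    have aff: "a + (t * d) * e = (1 - t) * (a + 0 * e) + t * (a + d * e)" for a d e :: real
      by (simp add: algebra_simps)
    show ?thesis unfolding E t(3) by (rule aff)
  qed
  also have "\<dots> \<ge> 0"
    using add_nonneg_nonneg[OF mult_nonneg_nonneg[OF _ E0, of "1 - t"] mult_nonneg_nonneg[OF t(1) E1]] t by simp
  finally show ?thesis .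
qed

section \<open>Energy levels of the oscillator\<close>

text \<open>The force of the equation \<open>u'' = - f(u)\<close>, positive and strictly increasing, with finite
  potential energy at minus infinity.\<close>

locale oscillator =
  fixes f f' :: "real \<Rightarrow> real"
  assumes f_deriv: "(f has_real_derivative f' t) (at t)"
    and f'_cont: "continuous_on UNIV f'"
    and f_pos: "0 < f t" and f'_pos: "0 < f' t"
    and f_int: "f integrable_on {..0}"
begin

lemma f_cont: "continuous_on S f"
  by (rule DERIV_continuous_on[where D=f']) (rule has_field_derivative_at_within[OF f_deriv])

lemma f_strict_mono: "x < y \<Longrightarrow> f x < f y"
  using DERIV_pos_imp_increasing[of x y f] f_deriv f'_pos by blast

lemma f_mono: "x \<le> y \<Longrightarrow> f x \<le> f y"
  using f_strict_mono[of x y] by (cases "x = y") auto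

lemma f_integrable: "f integrable_on {..u}"
proof (cases "u \<le> 0")
  case True
  have "f absolutely_integrable_on {..0}"
    by (intro nonnegative_absolutely_integrable_1 f_int) (simp add: f_pos less_imp_le)
  then have "f absolutely_integrable_on {..u}"
    by (rule set_integrable_subset) (use True in auto)
  then show ?thesis by (simp add: absolutely_integrable_on_def)
next
  case False
  have "f integrable_on {0..u}" by (intro integrable_continuous_real f_cont)
  moreover have "negligible ({..0} \<inter> {0..u})"
    by (rule negligible_subset[of "{0}"]) auto
  ultimately have "f integrable_on {..0} \<union> {0..u}"
    using has_integral_Un[OF integrable_integral[OF f_int] integrable_integral]
    by (metis has_integral_integrable)
  moreover have "{..0} \<union> {0..u} = {..u}" using False by auto
  ultimately show ?thesis by simp
qed

lemma F_diff:
  assumes "u \<le> v"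
  shows "F f v = F f u + integral {u..v} f"
proof -
  have "(f has_integral (integral {..u} f + integral {u..v} f)) ({..u} \<union> {u..v})"
  proof (intro has_integral_Un integrable_integral f_integrable integrable_continuous_real f_cont)
    show "negligible ({..u} \<inter> {u..v})" by (rule negligible_subset[of "{u}"]) auto
  qed
  moreover have "{..u} \<union> {u..v} = {..v}" using assms by auto
  ultimately show ?thesis by (simp add: F_def integral_unique)
qed

lemma F_deriv: "(F f has_real_derivative f u) (at u)"
proof -
  have "((\<lambda>x. F f (u - 1) + integral {u - 1..x} f) has_real_derivative f u) (at u within {u - 1..u + 1})"
    by (auto intro!: derivative_eq_intros integral_has_real_derivative f_cont)
  then have "((\<lambda>x. F f (u - 1) + integral {u - 1..x} f) has_real_derivative f u) (at u)"
    by (simp add: at_within_Icc_at)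
  then show ?thesis
  proof (rule has_field_derivative_transform_within_open)
    show "open {u - 1<..}" "u \<in> {u - 1<..}" by simp_all
    fix x assume "x \<in> {u - 1<..}"
    then show "F f (u - 1) + integral {u - 1..x} f = F f x"
      by (intro F_diff[symmetric]) simp
  qed
qed

lemma F_cont: "continuous_on S (F f)"
  by (rule DERIV_continuous_on[where D=f]) (rule has_field_derivative_at_within[OF F_deriv])

lemma F_strict_mono: "x < y \<Longrightarrow> F f x < F f y"
  by (rule DERIV_pos_imp_increasing) (auto intro!: exI conjI F_deriv f_pos)

lemma F_less_iff: "F f x < F f y \<longleftrightarrow> x < y"
  using F_strict_mono[of x y] F_strict_mono[of y x] by (cases x y rule: linorder_cases) auto

lemma F_pos: "0 < F f u"
proof -
  have "0 \<le> F f (u - 1)"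
    unfolding F_def by (intro integral_nonneg f_integrable) (simp add: f_pos less_imp_le)
  also have "\<dots> < F f u" by (rule F_strict_mono) simp
  finally show ?thesis .
qed

lemma F_tendsto_0: "(\<lambda>n. F f (- real n)) \<longlonglongrightarrow> 0"
proof -
  have "(\<lambda>n. integral {..0} (\<lambda>x. if x \<le> - real n then f x else 0)) \<longlonglongrightarrow> integral {..0::real} (\<lambda>x. 0)"
  proof (rule dominated_convergence(2))
    show "f integrable_on {..0}" by (rule f_int)
    show "(\<lambda>x. if x \<le> - real n then f x else 0) integrable_on {..0}" for n
    proof -
      have "(\<lambda>x. if x \<in> {..- real n} then f x else 0) integrable_on {..0}"
        using f_integrable[of "- real n"] by (subst integrable_restrict_Int) (simp add: min_def Int_absorb2)
      then show ?thesis by simp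
    qed
    show "norm (if x \<le> - real n then f x else 0) \<le> f x" for n x
      using f_pos[of x] by auto
    fix x :: real
    obtain N :: nat where "- x < real N" using reals_Archimedean2 by blast
    then have "\<forall>\<^sub>F n in sequentially. (if x \<le> - real n then f x else 0) = 0"
      unfolding eventually_sequentially by (intro exI[of _ N]) auto
    then show "(\<lambda>n. if x \<le> - real n then f x else 0) \<longlonglongrightarrow> 0"
      by (rule tendsto_eventually)
  qed
  moreover have "integral {..0} (\<lambda>x. if x \<le> - real n then f x else 0) = F f (- real n)" for n
  proof -
    have "integral {..0} (\<lambda>x. if x \<in> {..- real n} then f x else 0) = integral ({..0} \<inter> {..- real n}) f"
      by (simp only: integral_restrict_Int Int_commute)
    then show ?thesis by (simp add: F_def min_def)
  qed
  ultimately show ?thesis by simp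
qed

text \<open>The potential \<open>F\<close> tends to 0 at minus infinity because \<open>f\<close> is integrable there, and it grows at least
  linearly on the positive axis because \<open>f \<ge> f 0\<close> there.\<close>

lemma F_surj:
  assumes "0 < E"
  shows "\<exists>u. F f u = E"
proof -
  obtain a where a: "F f a < E"
  proof -
    have "\<forall>\<^sub>F n in sequentially. F f (- real n) < E"
      using F_tendsto_0 assms by (rule order_tendstoD(2))
    then show ?thesis using that by (auto dest: eventually_happens)
  qed
  have lin: "F f 0 + f 0 * u \<le> F f u" if "0 \<le> u" for u
  proof -
    have "integral {0..u} (\<lambda>x. f 0) \<le> integral {0..u} f"
      by (intro integral_le integrable_continuous_real f_cont continuous_intros) (auto intro: f_mono)
    then show ?thesis using F_diff[OF that] that by (simp add: mult.commute)
  qed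
  define c where "c = max a (E / f 0)"
  have "E \<le> F f c"
  proof (cases "c \<ge> 0")
    case True
    have "E = f 0 * (E / f 0)" using f_pos[of 0] by simp
    also have "\<dots> \<le> f 0 * c" using f_pos[of 0] by (intro mult_left_mono) (auto simp: c_def)
    also have "\<dots> \<le> F f c" using lin[OF True] F_pos[of 0] by linarith
    finally show ?thesis .
  next
    case False
    moreover have "0 < E / f 0" using assms f_pos[of 0] by simp
    ultimately show ?thesis by (simp add: c_def)
  qed
  then have "\<exists>u\<ge>a. u \<le> c \<and> F f u = E"
    using a by (intro IVT' F_cont) (auto simp: c_def)
  then show ?thesis by auto
qed

lemma Finv_F [simp]: "Finv f (F f u) = u"
  unfolding Finv_def by (intro inv_f_f injI) (metis F_less_iff linorder_neqE less_irrefl)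

lemma F_Finv [simp]: "0 < E \<Longrightarrow> F f (Finv f E) = E"
  using F_surj[of E] by auto

lemma Finv_deriv:
  assumes "0 < E"
  shows "(Finv f has_real_derivative 1 / f (Finv f E)) (at E)"
proof -
  have "isCont (Finv f) (F f (Finv f E))"
    by (rule isCont_inverse_function[where d=1 and f="F f" and x="Finv f E"]) (auto intro: DERIV_isCont F_deriv)
  then have "DERIV (Finv f) E :> inverse (f (Finv f E))"
    using assms f_pos[of "Finv f E"]
    by (intro DERIV_inverse_function[where a=0 and b="E+1" and f="F f"]) (auto intro: F_deriv)
  then show ?thesis by (simp add: inverse_eq_divide)
qed

text \<open>On the level \<open>C\<close>, the time spent per unit of \<open>v\<close> is \<open>slowness (C - v^2/2)\<close>, up to the factor \<open>1 / sqrt lam\<close>.\<close>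

definition slowness where "slowness E = 1 / f (Finv f E)"
definition slowness_decay where "slowness_decay E = f' (Finv f E) / f (Finv f E) ^ 3"

lemma Finv_cont: "continuous_on {0<..} (Finv f)"
  by (rule DERIV_continuous_on[where D="\<lambda>E. 1 / f (Finv f E)"]) (auto intro!: has_field_derivative_at_within[OF Finv_deriv])

lemma slowness_F [simp]: "slowness (F f u) = 1 / f u" by (simp add: slowness_def)

lemma slowness_pos: "0 < slowness E" by (simp add: slowness_def f_pos)

lemma slowness_deriv:
  assumes "0 < E"
  shows "(slowness has_real_derivative - slowness_decay E) (at E)"
proof -
  have "((\<lambda>E. 1 / f (Finv f E)) has_real_derivative
      - (f' (Finv f E) * (1 / f (Finv f E))) / (f (Finv f E))\<^sup>2) (at E)"
    using f_pos[of "Finv f E"]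
    by (auto intro!: derivative_eq_intros DERIV_chain2[OF f_deriv Finv_deriv] assms simp: power2_eq_square)
  moreover have "- (f' (Finv f E) * (1 / f (Finv f E))) / (f (Finv f E))\<^sup>2 = - slowness_decay E"
    by (simp add: slowness_decay_def power3_eq_cube power2_eq_square)
  moreover have "(\<lambda>E. 1 / f (Finv f E)) = slowness" by (auto simp: slowness_def)
  ultimately show ?thesis by simp
qed

lemma slowness_cont: "continuous_on {0<..} slowness"
  by (rule DERIV_continuous_on[where D="\<lambda>E. - slowness_decay E"]) (auto intro!: has_field_derivative_at_within[OF slowness_deriv])

lemma slowness_decay_cont: "continuous_on {0<..} slowness_decay"
  unfolding slowness_decay_def
  by (intro continuous_intros continuous_on_compose2[OF f'_cont Finv_cont]
      continuous_on_compose2[OF f_cont[of UNIV] Finv_cont]) (use f_pos in \<open>auto simp: less_imp_neq[symmetric]\<close>)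

text \<open>The energy at the point with abscissa \<open>v\<close> of the line \<open>u = k v\<close>. Taking both signs of \<open>k\<close> treats the two
  boundary lines together.\<close>

definition ray :: "real \<Rightarrow> real \<Rightarrow> real" where "ray k v = F f (k * v) + v\<^sup>2 / 2"

lemma ray_deriv: "(ray k has_real_derivative k * f (k * v) + v) (at v)"
  unfolding ray_def by (auto intro!: derivative_eq_intros DERIV_chain2[OF F_deriv])

lemma ray_cont: "continuous_on S (ray k)"
  by (rule DERIV_continuous_on[where D="\<lambda>v. k * f (k * v) + v"]) (rule has_field_derivative_at_within[OF ray_deriv])

lemma ray_slope_strict_mono:
  assumes "v < w"
  shows "k * f (k * v) + v < k * f (k * w) + w"
proof -
  have "k * f (k * v) \<le> k * f (k * w)"
  proof (cases "k \<ge> 0")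
    case True
    then show ?thesis using assms by (intro mult_left_mono f_mono) auto
  next
    case False
    then show ?thesis using assms by (intro mult_left_mono_neg f_mono) auto
  qed
  then show ?thesis using assms by simp
qed

text \<open>The energy along a ray is strictly convex in \<open>v\<close>, so once it exceeds its value at 0 it is increasing.\<close>

lemma ray_slope_pos:
  assumes "F f 0 < ray k v" "0 < v"
  shows "0 < k * f (k * v) + v"
proof -
  obtain z where z: "0 < z" "z < v" "ray k v - ray k 0 = (v - 0) * (k * f (k * z) + z)"
    using MVT2[of 0 v "ray k" "\<lambda>v. k * f (k * v) + v"] assms ray_deriv by blast
  have "0 < v * (k * f (k * z) + z)" using z assms by (simp add: ray_def)
  then have "0 < k * f (k * z) + z" using assms by (simp add: zero_less_mult_iff)
  then show ?thesis using ray_slope_strict_mono[OF z(2), of k] by linarith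
qed

lemma ray_strict_mono:
  assumes "F f 0 < ray k v" "0 < v" "v < w"
  shows "ray k v < ray k w"
proof -
  obtain z where z: "v < z" "z < w" "ray k w - ray k v = (w - v) * (k * f (k * z) + z)"
    using MVT2[of v w "ray k" "\<lambda>v. k * f (k * v) + v"] assms ray_deriv by blast
  have "0 < k * f (k * z) + z"
    using ray_slope_strict_mono[OF z(1), of k] ray_slope_pos[OF assms(1,2)] by linarith
  with assms have "0 < (w - v) * (k * f (k * z) + z)" by simp
  then show ?thesis using z(3) by linarith
qed

definition hit where "hit k C = (THE v. 0 < v \<and> ray k v = C)"

lemma hit_ex1:
  assumes "F f 0 < C"
  shows "\<exists>!v. 0 < v \<and> ray k v = C"
proof -
  have "C \<le> ray k (sqrt (2 * C))"
    using assms F_pos[of 0] F_pos[of "k * sqrt (2 * C)"] by (simp add: ray_def)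
  then have "\<exists>v\<ge>0. v \<le> sqrt (2 * C) \<and> ray k v = C"
    using assms F_pos[of 0] by (intro IVT' ray_cont) (auto simp: ray_def)
  then obtain v where v: "0 \<le> v" "ray k v = C" by auto
  have "v \<noteq> 0" using v assms by (auto simp: ray_def)
  with v have v: "0 < v" "ray k v = C" by auto
  have "w = v" if "0 < w" "ray k w = C" for w
    using ray_strict_mono[of k v w] ray_strict_mono[of k w v] v that assms by (cases v w rule: linorder_cases) auto
  with v show ?thesis by blast
qed

lemma hit_pos: "F f 0 < C \<Longrightarrow> 0 < hit k C"
  and ray_hit: "F f 0 < C \<Longrightarrow> ray k (hit k C) = C"
  using theI'[OF hit_ex1[of C k]] by (auto simp: hit_def)

lemma hit_eqI: "F f 0 < C \<Longrightarrow> 0 < v \<Longrightarrow> ray k v = C \<Longrightarrow> hit k C = v"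
  using hit_ex1[of C k] hit_pos[of C k] ray_hit[of C k] by blast

text \<open>The derivative of the energy along the ray at the point where the ray meets the level \<open>C\<close>.\<close>

definition slope where "slope k C = k * f (k * hit k C) + hit k C"

lemma slope_pos: "F f 0 < C \<Longrightarrow> 0 < slope k C"
  unfolding slope_def by (rule ray_slope_pos) (auto simp: hit_pos ray_hit)

lemma hit_deriv:
  assumes C: "F f 0 < C"
  shows "(hit k has_real_derivative 1 / slope k C) (at C)"
proof -
  let ?v = "hit k C"
  have v: "0 < ?v" "ray k ?v = C" by (simp_all add: C hit_pos ray_hit)
  have cont: "isCont (ray k) x" for x by (rule DERIV_isCont[OF ray_deriv])
  have "\<forall>\<^sub>F x in at ?v. F f 0 < ray k x"
    using order_tendstoD(1)[OF cont[of ?v, unfolded isCont_def]] C v by simp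
  then obtain e where e: "e > 0" "\<And>x. x \<noteq> ?v \<Longrightarrow> dist x ?v < e \<Longrightarrow> F f 0 < ray k x"
    unfolding eventually_at by auto
  have e2: "F f 0 < ray k x" if "dist x ?v < e" for x using e that C v by (cases "x = ?v") auto
  have "isCont (hit k) (ray k ?v)"
  proof (rule isCont_inverse_function[where d="min (e/2) (?v/2)" and f="ray k" and x="?v"])
    fix z assume "\<bar>z - ?v\<bar> \<le> min (e/2) (?v/2)"
    then have "0 < z" "dist z ?v < e" using v e unfolding dist_real_def by linarith+
    then show "hit k (ray k z) = z" using e2 by (intro hit_eqI) auto
  qed (use e v cont in auto)
  then have "DERIV (hit k) C :> inverse (slope k C)"
    using slope_pos[OF C, of k] C v
    by (intro DERIV_inverse_function[where a="F f 0" and b="C+1" and f="ray k"])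
      (auto simp: slope_def ray_hit intro: ray_deriv)
  then show ?thesis by (simp add: inverse_eq_divide)
qed

lemma hit_cont: "continuous_on {F f 0<..} (hit k)"
  by (rule DERIV_continuous_on[where D="\<lambda>C. 1 / slope k C"]) (auto intro!: has_field_derivative_at_within[OF hit_deriv])

lemma slope_cont: "continuous_on {F f 0<..} (slope k)"
  unfolding slope_def by (intro continuous_intros hit_cont continuous_on_compose2[OF f_cont[of UNIV]]) auto

lemma inverse_slope_cont: "continuous_on {F f 0<..} (\<lambda>C. 1 / slope k C)"
  by (intro continuous_intros slope_cont) (use slope_pos in \<open>auto simp: less_imp_neq[symmetric]\<close>)

lemma energy_at_hit: "F f 0 < C \<Longrightarrow> C - (hit k C)\<^sup>2 / 2 = F f (k * hit k C)"
  using ray_hit[of C k] by (simp add: ray_def)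

text \<open>For \<open>k = - b\<close> this is \<open>L1\<close> up to a constant factor, and \<open>arc_time (- b) - arc_time b\<close> is the transit time
  of the monotone solutions.\<close>

definition arc_time where "arc_time k C = integral {0..hit k C} (\<lambda>v. slowness (C - v\<^sup>2 / 2))"

lemma energy_pos:
  assumes "F f 0 < C" "0 \<le> v" "v \<le> hit k C"
  shows "0 < C - v\<^sup>2 / 2"
proof -
  have "v\<^sup>2 \<le> (hit k C)\<^sup>2" using assms by (intro power_mono) auto
  then show ?thesis using energy_at_hit[OF assms(1), of k] F_pos[of "k * hit k C"] by linarith
qed

lemma arc_time_deriv:
  assumes C: "F f 0 < C"
  shows "(arc_time k has_real_derivative
     1 / (slope k C * f (k * hit k C)) - integral {0..hit k C} (\<lambda>v. slowness_decay (C - v\<^sup>2 / 2))) (at C)"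
proof -
  have "((\<lambda>t. integral {0..hit k t} (\<lambda>p. slowness (t - p\<^sup>2 / 2))) has_real_derivative
      1 / slope k C * slowness (C - (hit k C)\<^sup>2 / 2) + integral {0..hit k C} (\<lambda>p. - slowness_decay (C - p\<^sup>2 / 2))) (at C)"
  proof (rule DERIV_integral_moving_end[where s="F f 0" and h'="\<lambda>p. p"])
    show "((\<lambda>p. p\<^sup>2 / 2) has_real_derivative p) (at p)" for p :: real
      by (auto intro!: derivative_eq_intros)
    show "p\<^sup>2 / 2 < t" if "F f 0 < t" "0 \<le> p" "p \<le> hit k t" for t p
      using energy_pos[OF that] by simp
  qed (auto intro!: hit_deriv inverse_slope_cont hit_pos slowness_deriv C continuous_intros slowness_decay_cont)
  moreover have "1 / slope k C * slowness (C - (hit k C)\<^sup>2 / 2) = 1 / (slope k C * f (k * hit k C))"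
    by (simp add: energy_at_hit C)
  moreover have "(\<lambda>t. integral {0..hit k t} (\<lambda>p. slowness (t - p\<^sup>2 / 2))) = arc_time k"
    by (simp add: arc_time_def fun_eq_iff)
  ultimately show ?thesis by simp
qed

section \<open>The lower part of a level curve\<close>

text \<open>The value of \<open>v\<close> at the point of height \<open>- p\<close> of the level \<open>C\<close>.\<close>

definition speed where "speed C p = sqrt (2 * (C - F f (- p)))"

definition left_int where "left_int b C = integral {0..b * hit (- b) C} (\<lambda>p. 1 / speed C p ^ 3)"

text \<open>The time from the ray \<open>u = - b v\<close> up to height 0 is the integral of \<open>1 / speed\<close> over the heights passed;
  \<open>defect\<close> is minus its derivative in \<open>C\<close>. The second term comes from the starting point.\<close>

definition defect where "defect b C = left_int b C - b / (hit (- b) C * slope (- b) C)"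

text \<open>The factor is \<open>V^5\<close> with \<open>V = sqrt (2 (C - F(0)))\<close>. With this power the bound for the quarter-circle
  integral of radius \<open>V\<close> reads \<open>scaled_defect / V^3\<close>, as the Abel bound requires.\<close>

definition scaled_defect where "scaled_defect b C = sqrt (2 * (C - F f 0)) ^ 5 * defect b C"

lemma F_le0: "0 \<le> p \<Longrightarrow> F f (- p) \<le> F f 0"
  using F_less_iff[of 0 "-p"] by linarith

lemma speed_cont: "F f 0 < C \<Longrightarrow> continuous_on {0..q} (speed C)"
  unfolding speed_def by (intro continuous_intros continuous_on_compose2[OF F_cont[of UNIV]]) auto

lemma speed_pos: "F f 0 < C \<Longrightarrow> 0 \<le> p \<Longrightarrow> 0 < speed C p"
  unfolding speed_def using F_le0[of p] by simp

lemma left_int_deriv: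
  assumes b: "0 < b" and C: "F f 0 < C"
  shows "(left_int b has_real_derivative
     b / (slope (- b) C * hit (- b) C ^ 3)
      - 3 * integral {0..b * hit (- b) C} (\<lambda>p. 1 / speed C p ^ 5)) (at C)"
proof -
  let ?n = "hit (- b)"
  have "((\<lambda>t. integral {0..b * ?n t} (\<lambda>p. 1 / sqrt (2 * (t - F f (- p))) ^ 3)) has_real_derivative
     b / slope (- b) C * (1 / sqrt (2 * (C - F f (- (b * ?n C)))) ^ 3) +
     integral {0..b * ?n C} (\<lambda>p. - 3 / sqrt (2 * (C - F f (- p))) ^ 5)) (at C)"
  proof (rule DERIV_integral_moving_end[where s="F f 0" and h'="\<lambda>p. - f (- p)" and g="\<lambda>e. 1 / sqrt (2 * e) ^ 3" and h="\<lambda>p. F f (- p)" and g'="\<lambda>e. - 3 / sqrt (2 * e) ^ 5"])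
    fix t assume t: "F f 0 < t"
    show "((\<lambda>t. b * ?n t) has_real_derivative b / slope (- b) t) (at t)"
      using DERIV_cmult[OF hit_deriv[OF t, of "- b"], of b] by simp
    show "0 < b * ?n t" using b hit_pos[OF t] by simp
    show "F f (- p) < t" if "0 \<le> p" for p using F_le0[OF that] t by simp
  next
    show "continuous_on {F f 0<..} (\<lambda>t. b / slope (- b) t)"
      using continuous_on_mult[OF continuous_on_const[of _ b] inverse_slope_cont[of "- b"]] by simp
    fix e :: real assume e: "0 < e"
    let ?s = "sqrt (2 * e)"
    have s: "0 < ?s" using e by simp
    have d: "((\<lambda>e. sqrt (2 * e)) has_real_derivative 1 / ?s) (at e)"
      using e by (auto intro!: derivative_eq_intros simp: divide_simps)
    have "((\<lambda>e. 1 / sqrt (2 * e) ^ 3) has_real_derivative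
        - (3 * ?s\<^sup>2 * (1 / ?s)) / (?s ^ 3 * ?s ^ 3)) (at e)"
      using DERIV_divide[OF DERIV_const[of 1] DERIV_power[OF d, of 3]] s
      by (simp add: mult_ac power2_eq_square)
    moreover have "- (3 * ?s\<^sup>2 * (1 / ?s)) / (?s ^ 3 * ?s ^ 3) = - 3 / ?s ^ 5"
      using s by (simp add: divide_simps eval_nat_numeral)
    ultimately show "((\<lambda>e. 1 / sqrt (2 * e) ^ 3) has_real_derivative - 3 / ?s ^ 5) (at e)" by simp
  next
    show "continuous_on {0<..} (\<lambda>e. - 3 / sqrt (2 * e) ^ 5)"
      by (intro continuous_intros) auto
    show "((\<lambda>p. F f (- p)) has_real_derivative - f (- p)) (at p)" for p
      using DERIV_chain2[OF F_deriv DERIV_minus[OF DERIV_ident], of p] by simp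
    show "continuous_on UNIV (\<lambda>p. - f (- p))"
      by (intro continuous_intros continuous_on_compose2[OF f_cont[of UNIV]]) auto
  qed (rule C)
  moreover have "2 * (C - F f (- (b * ?n C))) = (?n C)\<^sup>2"
    using energy_at_hit[OF C, of "- b"] by simp
  moreover have "integral S (\<lambda>p. - 3 / g p) = - 3 * integral S (\<lambda>p. 1 / g p)" for S :: "real set" and g :: "real \<Rightarrow> real"
  proof -
    have "integral S (\<lambda>p. - 3 / g p) = integral S (\<lambda>p. - 3 * (1 / g p))" by simp
    then show ?thesis by (simp only: integral_mult_right)
  qed
  ultimately show ?thesis
    using hit_pos[OF C, of "- b"] by (simp add: left_int_def[abs_def] speed_def)
qed

lemma slope_deriv:
  assumes "F f 0 < C"
  shows "(slope k has_real_derivative (1 + k\<^sup>2 * f' (k * hit k C)) / slope k C) (at C)"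
proof -
  have "((\<lambda>C. k * f (k * hit k C) + hit k C) has_real_derivative
     k * (f' (k * hit k C) * (k * (1 / slope k C))) + 1 / slope k C) (at C)"
    by (auto intro!: derivative_eq_intros DERIV_chain2[OF f_deriv] hit_deriv assms)
  moreover have "k * (f' (k * hit k C) * (k * (1 / slope k C))) + 1 / slope k C
     = (1 + k\<^sup>2 * f' (k * hit k C)) / slope k C"
    by (simp add: power2_eq_square add_divide_distrib mult_ac)
  ultimately show ?thesis by (simp add: slope_def[abs_def])
qed

text \<open>Below height 0 the force is at least its value \<open>f1\<close> at the starting point, so the speed is at most the
  speed \<open>sqrt (n^2 - 2 f1 (b n - p))\<close> for the constant force \<open>f1\<close>, while it is at least \<open>sqrt X\<close>. On this range
  the integrand is decreasing in the speed, and for the constant force the integral is explicit.\<close>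

lemma left_int_lower_bound:
  assumes b: "0 < b" and C: "F f 0 < C"
  defines "n \<equiv> hit (- b) C" and "X \<equiv> 2 * (C - F f 0)" and "f1 \<equiv> f (- b * hit (- b) C)"
  defines "c \<equiv> sqrt (n\<^sup>2 - 2 * f1 * (b * n))"
  shows "0 < n\<^sup>2 - 2 * f1 * (b * n)" "X \<le> c\<^sup>2" "c < n"
    and "5 / f1 * (1 / c - 1 / n) - X / f1 * (1 / c ^ 3 - 1 / n ^ 3)
      \<le> 5 * left_int b C - 3 * X * integral {0..b * n} (\<lambda>p. 1 / speed C p ^ 5)"
proof -
  have n: "0 < n" and bn: "0 < b * n" using b hit_pos[OF C] by (auto simp: n_def)
  have X: "0 < X" using C by (simp add: X_def)
  have f1: "0 < f1" by (simp add: f1_def f_pos)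
  have n2: "n\<^sup>2 = 2 * (C - F f (- (b * n)))"
    using energy_at_hit[OF C, of "- b"] by (simp add: n_def)
  have Fd: "f1 * (b * n - p) \<le> F f (- p) - F f (- (b * n))" if "p \<in> {0..b * n}" for p
  proof -
    have "integral {- (b * n)..- p} (\<lambda>_. f1) \<le> integral {- (b * n)..- p} f"
      by (intro integral_le integrable_continuous_real f_cont continuous_intros)
        (auto simp: f1_def n_def intro: f_mono)
    then show ?thesis using F_diff[of "- (b * n)" "- p"] that by (simp add: mult.commute)
  qed
  define L where "L = (\<lambda>p. n\<^sup>2 - 2 * f1 * (b * n - p))"
  have spL: "(speed C p)\<^sup>2 \<le> L p" "X \<le> (speed C p)\<^sup>2" if "p \<in> {0..b * n}" for p
  proof -
    have "(speed C p)\<^sup>2 = 2 * (C - F f (- p))"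
      using speed_pos[OF C, of p] that F_le0[of p] C by (simp add: speed_def)
    then show "(speed C p)\<^sup>2 \<le> L p" "X \<le> (speed C p)\<^sup>2"
      using Fd[OF that] n2 F_le0[of p] that by (auto simp: L_def X_def algebra_simps)
  qed
  have L0: "X \<le> L 0" using spL[of 0] bn by auto
  have Lp: "X \<le> L p" if "p \<in> {0..b * n}" for p using spL[OF that] by linarith
  show 1: "0 < n\<^sup>2 - 2 * f1 * (b * n)" using L0 X by (simp add: L_def)
  then have c2: "c\<^sup>2 = L 0" by (simp add: c_def L_def)
  with L0 show 2: "X \<le> c\<^sup>2" by simp
  have "c\<^sup>2 < n\<^sup>2" using f1 bn by (simp add: c2 L_def)
  then show 3: "c < n" using n by (simp add: power_less_imp_less_base)
  define q where "q = (\<lambda>p. sqrt (L p))"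
  have qpos: "0 < q p" if "p \<in> {0..b * n}" for p using Lp[OF that] X by (simp add: q_def)
  have q0: "q 0 = c" and qn: "q (b * n) = n" using n by (simp_all add: q_def c_def L_def)
  have dq: "(q has_real_derivative f1 / q p) (at p within S)" if "p \<in> {0..b * n}" for p S
  proof -
    have "(L has_real_derivative 2 * f1) (at p within S)"
      unfolding L_def by (auto intro!: derivative_eq_intros)
    then show ?thesis
      unfolding q_def using Lp[OF that] X
      by (auto intro!: derivative_eq_intros simp: divide_simps)
  qed
  have qc: "continuous_on {0..b * n} q"
    by (rule DERIV_continuous_on[where D="\<lambda>p. f1 / q p"]) (rule dq)
  have I: "((\<lambda>p. 1 / q p ^ 3) has_integral (- (1 / (f1 * q (b * n)))) - (- (1 / (f1 * q 0)))) {0..b * n}"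
  proof (rule FTC_real)
    fix p assume p: "p \<in> {0..b * n}"
    have "((\<lambda>p. - (1 / (f1 * q p))) has_real_derivative (f1 * (f1 / q p)) / (f1 * q p)\<^sup>2) (at p within {0..b * n})"
      using f1 qpos[OF p] by (auto intro!: derivative_eq_intros dq[OF p] simp: power2_eq_square)
    moreover have "(f1 * (f1 / q p)) / (f1 * q p)\<^sup>2 = 1 / q p ^ 3"
      using f1 qpos[OF p] by (simp add: field_simps power2_eq_square power3_eq_cube)
    ultimately show "((\<lambda>p. - (1 / (f1 * q p))) has_real_derivative 1 / q p ^ 3) (at p within {0..b * n})" by simp
  qed (use bn in simp)
  have J: "((\<lambda>p. 1 / q p ^ 5) has_integral (- (1 / (3 * f1 * q (b * n) ^ 3))) - (- (1 / (3 * f1 * q 0 ^ 3)))) {0..b * n}"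
  proof (rule FTC_real)
    fix p assume p: "p \<in> {0..b * n}"
    have "((\<lambda>p. - (1 / (3 * f1 * q p ^ 3))) has_real_derivative
        (3 * f1 * (3 * (q p)\<^sup>2 * (f1 / q p))) / (3 * f1 * q p ^ 3)\<^sup>2) (at p within {0..b * n})"
      using f1 qpos[OF p] by (auto intro!: derivative_eq_intros dq[OF p] simp: power2_eq_square)
    moreover have "(3 * f1 * (3 * (q p)\<^sup>2 * (f1 / q p))) / (3 * f1 * q p ^ 3)\<^sup>2 = 1 / q p ^ 5"
      using f1 qpos[OF p] by (simp add: field_simps power2_eq_square eval_nat_numeral)
    ultimately show "((\<lambda>p. - (1 / (3 * f1 * q p ^ 3))) has_real_derivative 1 / q p ^ 5) (at p within {0..b * n})" by simp
  qed (use bn in simp)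
  have Q: "((\<lambda>p. 5 * (1 / q p ^ 3) - 3 * X * (1 / q p ^ 5)) has_integral
      5 / f1 * (1 / c - 1 / n) - X / f1 * (1 / c ^ 3 - 1 / n ^ 3)) {0..b * n}"
    using has_integral_diff[OF has_integral_mult_right[OF I, of 5] has_integral_mult_right[OF J, of "3 * X"]]
    by (simp add: q0 qn algebra_simps diff_divide_distrib)
  have ne: "speed C p \<noteq> 0" if "p \<in> {0..b * n}" for p using speed_pos[OF C, of p] that by auto
  have i3: "(\<lambda>p. 1 / speed C p ^ 3) integrable_on {0..b * n}"
    and i5: "(\<lambda>p. 1 / speed C p ^ 5) integrable_on {0..b * n}"
    by (intro integrable_continuous_real continuous_intros speed_cont[OF C]; use ne in auto)+
  have S: "((\<lambda>p. 5 * (1 / speed C p ^ 3) - 3 * X * (1 / speed C p ^ 5)) has_integral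
      5 * left_int b C - 3 * X * integral {0..b * n} (\<lambda>p. 1 / speed C p ^ 5)) {0..b * n}"
    unfolding left_int_def n_def[symmetric]
    by (intro has_integral_diff has_integral_mult_right integrable_integral i3 i5)
  show "5 / f1 * (1 / c - 1 / n) - X / f1 * (1 / c ^ 3 - 1 / n ^ 3)
      \<le> 5 * left_int b C - 3 * X * integral {0..b * n} (\<lambda>p. 1 / speed C p ^ 5)"
  proof (rule has_integral_le[OF Q S])
    fix p assume p: "p \<in> {0..b * n}"
    have s: "0 < speed C p" using speed_pos[OF C] p by simp
    have "speed C p \<le> q p" using spL(1)[OF p] s by (simp add: q_def real_le_rsqrt)
    then have "1 / q p \<le> 1 / speed C p" using s by (simp add: frac_le)
    moreover have "X * (1 / speed C p)\<^sup>2 \<le> 1" using spL(2)[OF p] s by (simp add: field_simps)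
    ultimately have "5 * (1 / q p) ^ 3 - 3 * X * (1 / q p) ^ 5 \<le> 5 * (1 / speed C p) ^ 3 - 3 * X * (1 / speed C p) ^ 5"
      using qpos[OF p] X by (intro cube_quint_antimono) auto
    then show "5 * (1 / q p ^ 3) - 3 * X * (1 / q p ^ 5) \<le> 5 * (1 / speed C p ^ 3) - 3 * X * (1 / speed C p ^ 5)"
      by (simp add: power_one_over)
  qed
qed

text \<open>The derivative is \<open>V^3\<close> times an expression \<open>P\<close> that differs from its counterpart for the constant force
  \<open>f (- b n)\<close> by a positive multiple of \<open>f' (- b n)\<close> and by the gain in \<open>left_int_lower_bound\<close>.\<close>

lemma scaled_defect_deriv_pos:
  assumes b: "0 < b" and C: "F f 0 < C"
  shows "\<exists>D > 0. (scaled_defect b has_real_derivative D) (at C)"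
proof -
  define n where "n = hit (- b) C"
  define s where "s = slope (- b) C"
  define X where "X = 2 * (C - F f 0)"
  define V where "V = sqrt X"
  define f1 where "f1 = f (- b * n)"
  define g where "g = f' (- b * n)"
  define I5 where "I5 = integral {0..b * n} (\<lambda>p. 1 / speed C p ^ 5)"
  define c where "c = sqrt (n\<^sup>2 - 2 * f1 * (b * n))"
  have n: "0 < n" and s: "0 < s" and X: "0 < X" and V: "0 < V" "V\<^sup>2 = X"
    using hit_pos[OF C] slope_pos[OF C] C by (auto simp: n_def s_def X_def V_def)
  have f1: "0 < f1" and g: "0 < g" by (simp_all add: f1_def g_def f_pos f'_pos)
  note lb = left_int_lower_bound[OF b C, folded n_def X_def, folded f1_def, folded c_def, folded I5_def]
  have c0: "0 < c" using lb(1) by (simp add: c_def)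
  have c2: "c\<^sup>2 = n\<^sup>2 - 2 * f1 * (b * n)" using lb(1) by (simp add: c_def)
  have bf: "b * f1 = (n\<^sup>2 - c\<^sup>2) / (2 * n)" using n by (simp add: c2 field_simps)
  have sK: "n * s = (n\<^sup>2 + c\<^sup>2) / 2"
  proof -
    have "s = n - b * f1" by (simp add: s_def slope_def n_def f1_def)
    then have "n * s = n * (n - b * f1)" by simp
    also have "\<dots> = n\<^sup>2 - f1 * (b * n)" by (simp add: power2_eq_square algebra_simps)
    finally have "n * s = n\<^sup>2 - f1 * (b * n)" .
    then show ?thesis using c2 by simp
  qed
  define P where "P = 5 * defect b C - 3 * X * I5 + X * b * (1 / (s * n ^ 3) + 1 / (n * s)\<^sup>2 + (1 + b\<^sup>2 * g) / (n * s ^ 3))"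
  have "0 < P"
  proof -
    have n2c: "n\<^sup>2 - c\<^sup>2 > 0" using f1 b n by (simp add: c2)
    have q: "1 / f1 = b * (2 * n / (n\<^sup>2 - c\<^sup>2))"
    proof -
      define Z where "Z = 2 * n / (n\<^sup>2 - c\<^sup>2)"
      have "b * f1 * Z = 1" unfolding bf Z_def using n n2c by simp
      then have "b * Z * f1 = 1" by (simp add: mult_ac)
      then have "b * Z = 1 / f1" using f1 by (intro eq_divide_imp) auto
      then show ?thesis unfolding Z_def by (rule sym)
    qed
    let ?K = "(n\<^sup>2 + c\<^sup>2) / 2"
    have "0 \<le> b * (5 * (2 * n / (n\<^sup>2 - c\<^sup>2)) * (1 / c - 1 / n)
     - X * (2 * n / (n\<^sup>2 - c\<^sup>2)) * (1 / c ^ 3 - 1 / n ^ 3)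
     - 5 / ?K + X * (1 / (n\<^sup>2 * ?K) + 1 / ?K\<^sup>2 + n\<^sup>2 / ?K ^ 3))"
      using constant_force_inequality[OF c0 lb(3) X lb(2) refl] b by simp
    also have "\<dots> = 5 * (1 / f1) * (1 / c - 1 / n) - X * (1 / f1) * (1 / c ^ 3 - 1 / n ^ 3)
        - 5 * (b / (n * s)) + X * b * (1 / (n\<^sup>2 * (n * s)) + 1 / (n * s)\<^sup>2 + n\<^sup>2 / (n * s) ^ 3)"
      unfolding q sK[symmetric] by (simp only: ring_distribs mult_ac times_divide_eq_left times_divide_eq_right)
    also have "\<dots> \<le> 5 * left_int b C - 3 * X * I5
        - 5 * (b / (n * s)) + X * b * (1 / (n\<^sup>2 * (n * s)) + 1 / (n * s)\<^sup>2 + n\<^sup>2 / (n * s) ^ 3)"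
      using lb(4) by simp
    also have "\<dots> = 5 * defect b C - 3 * X * I5 + X * b * (1 / (s * n ^ 3) + 1 / (n * s)\<^sup>2 + 1 / (n * s ^ 3))"
    proof -
      have "1 / (n\<^sup>2 * (n * s)) = 1 / (s * n ^ 3)" "n\<^sup>2 / (n * s) ^ 3 = 1 / (n * s ^ 3)"
        using n s by (simp_all add: field_simps power2_eq_square power3_eq_cube)
      then show ?thesis by (simp add: defect_def n_def[symmetric] s_def[symmetric])
    qed
    also have "\<dots> < P"
    proof -
      have "1 / (n * s ^ 3) < (1 + b\<^sup>2 * g) / (n * s ^ 3)"
        using n s b g by (intro divide_strict_right_mono) auto
      then have "X * b * (1 / (s * n ^ 3) + 1 / (n * s)\<^sup>2 + 1 / (n * s ^ 3))
         < X * b * (1 / (s * n ^ 3) + 1 / (n * s)\<^sup>2 + (1 + b\<^sup>2 * g) / (n * s ^ 3))"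
        using X b by (intro mult_strict_left_mono) auto
      then show ?thesis by (simp add: P_def)
    qed
    finally show ?thesis .
  qed
  have dm: "((\<lambda>C. b / (hit (- b) C * slope (- b) C)) has_real_derivative
     - (b * (1 / s * s + (1 + b\<^sup>2 * g) / s * n)) / (n * s)\<^sup>2) (at C)"
  proof -
    have "((\<lambda>C. hit (- b) C * slope (- b) C) has_real_derivative 1 / s * s + (1 + b\<^sup>2 * g) / s * n) (at C)"
      using DERIV_mult[OF hit_deriv[OF C, of "- b"] slope_deriv[OF C, of "- b"]]
      by (simp add: n_def s_def g_def)
    from DERIV_divide[OF DERIV_const[of b] this] n s show ?thesis
      by (simp add: n_def[symmetric] s_def[symmetric] power2_eq_square)
  qed
  have dd: "(defect b has_real_derivative b / (s * n ^ 3) - 3 * I5 -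
      (- (b * (1 / s * s + (1 + b\<^sup>2 * g) / s * n)) / (n * s)\<^sup>2)) (at C)"
    using DERIV_diff[OF left_int_deriv[OF b C] dm]
    by (simp add: defect_def[abs_def] n_def s_def I5_def)
  have dV: "((\<lambda>C. sqrt (2 * (C - F f 0))) has_real_derivative 1 / V) (at C)"
    using X unfolding V_def X_def by (auto intro!: derivative_eq_intros simp: divide_simps)
  have dV5: "((\<lambda>C. sqrt (2 * (C - F f 0)) ^ 5) has_real_derivative 5 * V ^ 3) (at C)"
  proof -
    have "((\<lambda>C. sqrt (2 * (C - F f 0)) ^ 5) has_real_derivative 5 * V ^ 4 * (1 / V)) (at C)"
      using DERIV_power[OF dV, of 5] by (simp add: V_def X_def mult_ac)
    moreover have "5 * V ^ 4 * (1 / V) = 5 * V ^ 3" using V by (simp add: eval_nat_numeral)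
    ultimately show ?thesis by simp
  qed
  have "(scaled_defect b has_real_derivative 5 * V ^ 3 * defect b C + (b / (s * n ^ 3) - 3 * I5 -
      (- (b * (1 / s * s + (1 + b\<^sup>2 * g) / s * n)) / (n * s)\<^sup>2)) * V ^ 5) (at C)"
    using DERIV_mult[OF dV5 dd] by (simp add: scaled_defect_def[abs_def] V_def X_def)
  moreover have "5 * V ^ 3 * defect b C + (b / (s * n ^ 3) - 3 * I5 -
      (- (b * (1 / s * s + (1 + b\<^sup>2 * g) / s * n)) / (n * s)\<^sup>2)) * V ^ 5 = V ^ 3 * P"
  proof -
    have V5: "V ^ 5 = V ^ 3 * X" using V(2) by (simp add: eval_nat_numeral power2_eq_square)
    have quot: "- (b * (1 / s * s + (1 + b\<^sup>2 * g) / s * n)) / (n * s)\<^sup>2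
        = - (b * (1 / (n * s)\<^sup>2 + (1 + b\<^sup>2 * g) / (n * s ^ 3)))"
      using n s by (simp add: field_simps power2_eq_square power3_eq_cube)
    show ?thesis
      by (simp only: P_def V5 quot) (simp add: algebra_simps)
  qed
  ultimately show ?thesis using \<open>0 < P\<close> V by (intro exI[of _ "V ^ 3 * P"]) simp
qed

lemma scaled_defect_strict_mono:
  assumes "0 < b" "F f 0 < C" "C < C'"
  shows "scaled_defect b C < scaled_defect b C'"
  using assms(3) by (rule DERIV_pos_imp_increasing)
    (use scaled_defect_deriv_pos[OF assms(1)] assms(2) in \<open>metis less_le_trans\<close>)

section \<open>Monotonicity of the transit time\<close>

text \<open>With \<open>z = sqrt (2 (F(u) - F(0)))\<close> as a coordinate for the height, this is \<open>z\<close> times the second derivative of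
  \<open>u\<close> with respect to \<open>z\<close>. It vanishes identically for a force proportional to \<open>u\<close>, where the period does not depend on the
  radius.\<close>

definition period_density where "period_density z = z * slowness (F f 0 + z\<^sup>2 / 2) - z ^ 3 * slowness_decay (F f 0 + z\<^sup>2 / 2)"

lemma level_pos: "0 < F f 0 + z\<^sup>2 / 2"
  using F_pos[of 0] by (intro add_pos_nonneg) auto

lemma period_density_cont: "continuous_on S period_density"
  unfolding period_density_def
  by (intro continuous_intros continuous_on_compose2[OF slowness_cont] continuous_on_compose2[OF slowness_decay_cont])
    (auto intro: level_pos)

lemma slowness_level_deriv: "((\<lambda>z. slowness (F f 0 + z\<^sup>2 / 2)) has_real_derivative - slowness_decay (F f 0 + z\<^sup>2 / 2) * z) (at z within S)"
proof -
  have "((\<lambda>z. F f 0 + z\<^sup>2 / 2) has_real_derivative z) (at z within S)"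
    by (auto intro!: derivative_eq_intros)
  from DERIV_chain2[OF slowness_deriv[OF level_pos] this] show ?thesis .
qed

text \<open>An integration by parts that trades the angle \<open>t\<close> for \<open>v = V cos t\<close>. For \<open>p = 0\<close> it identifies the
  quarter-circle integral, and for \<open>cos p = w / V\<close> the part of the arc that the solution does not reach.\<close>

lemma integral_period_density_tail:
  assumes V: "0 < V" and p: "0 \<le> p" "p \<le> pi/2"
  shows "integral {p..pi/2} (\<lambda>t. period_density (V * sin t))
    = V * cos p * slowness (F f 0 + (V * sin p)\<^sup>2 / 2)
      - V\<^sup>2 * integral {0..V * cos p} (\<lambda>v. slowness_decay (F f 0 + (V\<^sup>2 - v\<^sup>2) / 2))"
proof -
  let ?k = "\<lambda>v. slowness_decay (F f 0 + (V\<^sup>2 - v\<^sup>2) / 2)"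
  let ?A = "\<lambda>t. V\<^sup>2 * integral {0..V * cos t} ?k - V * cos t * slowness (F f 0 + (V * sin t)\<^sup>2 / 2)"
  have ck: "continuous_on {0..V} ?k"
  proof (intro continuous_on_compose2[OF slowness_decay_cont] continuous_intros)
    show "(\<lambda>v. F f 0 + (V\<^sup>2 - v\<^sup>2) / 2) ` {0..V} \<subseteq> {0<..}"
    proof clarsimp
      fix v assume "0 \<le> v" "v \<le> V"
      then have "v\<^sup>2 \<le> V\<^sup>2" by (intro power_mono)
      then have "0 \<le> (V\<^sup>2 - v\<^sup>2) / 2" by simp
      then show "0 < F f 0 + (V\<^sup>2 - v\<^sup>2) / 2" using F_pos[of 0] by linarith
    qed
  qed auto
  have "((\<lambda>t. period_density (V * sin t)) has_integral ?A (pi/2) - ?A p) {p..pi/2}"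
  proof (rule FTC_real[OF p(2)])
    fix t assume t: "t \<in> {p..pi/2}"
    let ?S = "{p..pi/2}"
    have cs: "V * cos t \<in> {0..V}" if "t \<in> ?S" for t
    proof -
      have "0 \<le> cos t" using that p by (intro cos_ge_zero) auto
      then show ?thesis using V by (simp add: mult_left_le)
    qed
    have i1: "((\<lambda>x. integral {0..x} ?k) has_real_derivative ?k (V * cos t)) (at (V * cos t) within (\<lambda>t. V * cos t) ` ?S)"
      using integral_has_real_derivative[OF ck cs[OF t]] by (rule DERIV_subset) (use cs in auto)
    have i2: "((\<lambda>t. V * cos t) has_real_derivative V * - sin t) (at t within ?S)"
      by (auto intro!: derivative_eq_intros)
    have d1: "((\<lambda>t. integral {0..V * cos t} ?k) has_real_derivative ?k (V * cos t) * (V * - sin t)) (at t within ?S)"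
      using DERIV_image_chain[OF i1 i2] unfolding o_def .
    have "((\<lambda>t. V * sin t) has_real_derivative V * cos t) (at t within ?S)"
      by (auto intro!: derivative_eq_intros)
    from DERIV_chain2[OF slowness_level_deriv[of "V * sin t" UNIV] this]
    have d2: "((\<lambda>t. slowness (F f 0 + (V * sin t)\<^sup>2 / 2)) has_real_derivative
        - slowness_decay (F f 0 + (V * sin t)\<^sup>2 / 2) * (V * sin t) * (V * cos t)) (at t within ?S)" .
    have c2: "V\<^sup>2 - (V * cos t)\<^sup>2 = (V * sin t)\<^sup>2"
      by (simp add: power_mult_distrib sin_squared_eq algebra_simps)
    define kk where "kk = slowness_decay (F f 0 + (V * sin t)\<^sup>2 / 2)"
    define rr where "rr = slowness (F f 0 + (V * sin t)\<^sup>2 / 2)"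
    have kk: "?k (V * cos t) = kk" unfolding c2 kk_def ..
    have "(?A has_real_derivative V\<^sup>2 * (kk * (V * - sin t))
       - (V * cos t * (- kk * (V * sin t) * (V * cos t)) + V * - sin t * rr)) (at t within ?S)"
      using d1 d2 unfolding kk kk_def[symmetric]
      by (auto intro!: derivative_eq_intros simp: rr_def)
    moreover have "V\<^sup>2 * (kk * (V * - sin t))
       - (V * cos t * (- kk * (V * sin t) * (V * cos t)) + V * - sin t * rr) = period_density (V * sin t)"
    proof -
      have "V\<^sup>2 * (kk * (V * - sin t)) - (V * cos t * (- kk * (V * sin t) * (V * cos t)) + V * - sin t * rr)
        = V * sin t * rr - V * sin t * kk * (V\<^sup>2 - (V * cos t)\<^sup>2)"
        by (simp add: power2_eq_square algebra_simps)
      then show ?thesis unfolding c2 by (simp add: period_density_def kk_def rr_def power3_eq_cube power2_eq_square)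
    qed
    ultimately show "(?A has_real_derivative period_density (V * sin t)) (at t within ?S)" by simp
  qed
  then show ?thesis by (simp add: integral_unique)
qed

text \<open>In the coordinate \<open>z = V sin t\<close> the integrand is \<open>z u''(z) dz / V\<close>, which integrates to \<open>(z u'(z) - u) / V\<close>.\<close>

lemma integral_period_density_cos:
  assumes V: "0 < V" and p: "0 \<le> p"
  shows "integral {0..p} (\<lambda>t. period_density (V * sin t) * cos t)
    = ((V * sin p)\<^sup>2 * slowness (F f 0 + (V * sin p)\<^sup>2 / 2) - Finv f (F f 0 + (V * sin p)\<^sup>2 / 2)) / V"
proof -
  let ?N = "\<lambda>z. z\<^sup>2 * slowness (F f 0 + z\<^sup>2 / 2) - Finv f (F f 0 + z\<^sup>2 / 2)"
  have dN: "(?N has_real_derivative period_density z) (at z)" for z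
  proof -
    have "((\<lambda>z. F f 0 + z\<^sup>2 / 2) has_real_derivative z) (at z)"
      by (auto intro!: derivative_eq_intros)
    from DERIV_chain2[OF Finv_deriv[OF level_pos] this]
    have "((\<lambda>z. Finv f (F f 0 + z\<^sup>2 / 2)) has_real_derivative slowness (F f 0 + z\<^sup>2 / 2) * z) (at z)"
      by (simp add: slowness_def)
    moreover have "((\<lambda>z. z\<^sup>2) has_real_derivative 2 * z) (at z)"
      by (auto intro!: derivative_eq_intros)
    ultimately have "(?N has_real_derivative 2 * z * slowness (F f 0 + z\<^sup>2 / 2) + (- slowness_decay (F f 0 + z\<^sup>2 / 2) * z) * z\<^sup>2
        - slowness (F f 0 + z\<^sup>2 / 2) * z) (at z)"
      by (intro DERIV_diff DERIV_mult slowness_level_deriv)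
    moreover have "2 * z * slowness (F f 0 + z\<^sup>2 / 2) + (- slowness_decay (F f 0 + z\<^sup>2 / 2) * z) * z\<^sup>2 - slowness (F f 0 + z\<^sup>2 / 2) * z = period_density z"
      by (simp add: period_density_def power2_eq_square power3_eq_cube algebra_simps)
    ultimately show ?thesis by simp
  qed
  have "((\<lambda>t. period_density (V * sin t) * cos t) has_integral ?N (V * sin p) / V - ?N (V * sin 0) / V) {0..p}"
  proof (rule FTC_real[OF p])
    fix t
    have "((\<lambda>t. V * sin t) has_real_derivative V * cos t) (at t within {0..p})"
      by (auto intro!: derivative_eq_intros)
    from DERIV_cdivide[OF DERIV_chain2[OF dN this], of V]
    show "((\<lambda>t. ?N (V * sin t) / V) has_real_derivative period_density (V * sin t) * cos t) (at t within {0..p})"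
      using V by simp
  qed
  then show ?thesis by (simp add: integral_unique)
qed

text \<open>Change variables from \<open>v\<close> to the depth \<open>p\<close>, then integrate by parts to remove \<open>f'\<close>.\<close>

lemma integral_slowness_decay_left:
  assumes b: "0 < b" and C: "F f 0 < C"
  defines "n \<equiv> hit (- b) C" and "V \<equiv> sqrt (2 * (C - F f 0))"
  shows "integral {V..n} (\<lambda>v. slowness_decay (C - v\<^sup>2 / 2))
     = 1 / (f (- b * n) * n) - 1 / (f 0 * V) + left_int b C"
proof -
  have n: "0 < n" and bn: "0 < b * n" using b hit_pos[OF C] by (auto simp: n_def)
  have sp0: "speed C 0 = V" by (simp add: speed_def V_def)
  have "2 * (C - F f (- (b * n))) = n\<^sup>2"
    using energy_at_hit[OF C, of "- b"] by (simp add: n_def)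
  then have spn: "speed C (b * n) = n" using n by (simp add: speed_def)
  have spos: "0 < speed C p" if "p \<in> {0..b * n}" for p using speed_pos[OF C] that by simp
  have sq: "C - (speed C p)\<^sup>2 / 2 = F f (- p)" if "p \<in> {0..b * n}" for p
    using F_le0[of p] C that by (simp add: speed_def field_simps)
  have dF: "((\<lambda>p. F f (- p)) has_real_derivative - f (- p)) (at p within S)" for p S
    using DERIV_chain2[OF F_deriv DERIV_minus[OF DERIV_ident], of p S] by simp
  have df: "((\<lambda>p. f (- p)) has_real_derivative - f' (- p)) (at p within S)" for p S
    using DERIV_chain2[OF f_deriv DERIV_minus[OF DERIV_ident], of p S] by simp
  have dsp: "(speed C has_real_derivative f (- p) / speed C p) (at p within {0..b * n})"
    if p: "p \<in> {0..b * n}" for p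
  proof -
    have "0 < 2 * (C - F f (- p))" using F_le0[of p] C p by simp
    then show ?thesis unfolding speed_def[abs_def]
      by (auto intro!: derivative_eq_intros dF simp: divide_simps)
  qed
  have spV: "speed C p \<in> {V..n}" if p: "p \<in> {0..b * n}" for p
  proof -
    have "F f (- (b * n)) \<le> F f (- p)" using F_less_iff[of "- p" "- (b * n)"] p by auto
    then have "2 * (C - F f (- p)) \<le> n\<^sup>2" unfolding \<open>2 * (C - F f (- (b * n))) = n\<^sup>2\<close>[symmetric] by simp
    then have "speed C p \<le> n" using n by (simp add: speed_def real_le_lsqrt)
    moreover have "V \<le> speed C p" using F_le0[of p] p by (simp add: speed_def V_def)
    ultimately show ?thesis by simp
  qed
  have Vn: "V \<le> n" using spV[of 0] sp0 bn by simp
  have V0: "0 < V" using C by (simp add: V_def)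
  have kc: "continuous_on {V..n} (\<lambda>v. slowness_decay (C - v\<^sup>2 / 2))"
    by (intro continuous_on_compose2[OF slowness_decay_cont] continuous_intros)
      (use energy_pos[OF C, of _ "- b"] V0 in \<open>auto simp: n_def\<close>)
  have "((\<lambda>p. (f (- p) / speed C p) *\<^sub>R slowness_decay (C - (speed C p)\<^sup>2 / 2)) has_integral
      integral {speed C 0..speed C (b * n)} (\<lambda>v. slowness_decay (C - v\<^sup>2 / 2))) {0..b * n}"
  proof (rule has_integral_substitution[where c=V and d=n])
    show "speed C 0 \<le> speed C (b * n)" using sp0 spn Vn by simp
    show "speed C ` {0..b * n} \<subseteq> {V..n}" using spV by auto
  qed (use bn kc dsp in auto)
  then have 1: "((\<lambda>p. (f (- p) / speed C p) * slowness_decay (C - (speed C p)\<^sup>2 / 2)) has_integral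
      integral {V..n} (\<lambda>v. slowness_decay (C - v\<^sup>2 / 2))) {0..b * n}"
    by (simp add: sp0 spn)
  have "((\<lambda>p. (f (- p) / speed C p) * slowness_decay (C - (speed C p)\<^sup>2 / 2) - 1 / speed C p ^ 3) has_integral
     1 / (f (- (b * n)) * speed C (b * n)) - 1 / (f (- 0) * speed C 0)) {0..b * n}"
  proof (rule FTC_real)
    fix p assume p: "p \<in> {0..b * n}"
    have pos: "0 < f (- p)" "0 < speed C p" using f_pos spos[OF p] by auto
    have "((\<lambda>p. 1 / (f (- p) * speed C p)) has_real_derivative
        - (- f' (- p) * speed C p + f (- p) / speed C p * f (- p)) / (f (- p) * speed C p)\<^sup>2)
        (at p within {0..b * n})"
      using DERIV_divide[OF DERIV_const[of 1] DERIV_mult[OF df dsp[OF p]]] pos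
      by (simp add: power2_eq_square)
    moreover have "- (- f' (- p) * speed C p + f (- p) / speed C p * f (- p)) / (f (- p) * speed C p)\<^sup>2
        = (f (- p) / speed C p) * slowness_decay (C - (speed C p)\<^sup>2 / 2) - 1 / speed C p ^ 3"
      unfolding sq[OF p] slowness_decay_def Finv_F using pos
      by (simp add: field_simps power2_eq_square power3_eq_cube)
    ultimately show "((\<lambda>p. 1 / (f (- p) * speed C p)) has_real_derivative
       (f (- p) / speed C p) * slowness_decay (C - (speed C p)\<^sup>2 / 2) - 1 / speed C p ^ 3) (at p within {0..b * n})"
      by simp
  qed (use bn in simp)
  then have 2: "((\<lambda>p. (f (- p) / speed C p) * slowness_decay (C - (speed C p)\<^sup>2 / 2) - 1 / speed C p ^ 3) has_integral
     1 / (f (- (b * n)) * n) - 1 / (f 0 * V)) {0..b * n}"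
    by (simp only: sp0 spn minus_zero)
  have "speed C p ^ 3 \<noteq> 0" if "p \<in> {0..b * n}" for p using spos[OF that] by simp
  then have 3: "((\<lambda>p. 1 / speed C p ^ 3) has_integral left_int b C) {0..b * n}"
    unfolding left_int_def n_def[symmetric]
    by (intro integrable_integral integrable_continuous_real continuous_intros speed_cont[OF C]) auto
  have 4: "((\<lambda>p. (f (- p) / speed C p) * slowness_decay (C - (speed C p)\<^sup>2 / 2)) has_integral
     1 / (f (- (b * n)) * n) - 1 / (f 0 * V) + left_int b C) {0..b * n}"
    using has_integral_add[OF 2 3] by (simp only: diff_add_cancel)
  show ?thesis using has_integral_unique[OF 1 4] by simp
qed

lemma hit_left_gt:
  assumes b: "0 < b" and C: "F f 0 < C"
  shows "sqrt (2 * (C - F f 0)) < hit (- b) C"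
proof (rule power_less_imp_less_base[of _ 2])
  have "F f (- b * hit (- b) C) < F f 0" using b hit_pos[OF C, of "- b"] by (intro F_strict_mono) simp
  then show "(sqrt (2 * (C - F f 0)))\<^sup>2 < (hit (- b) C)\<^sup>2"
    using energy_at_hit[OF C, of "- b"] C by simp
  show "0 \<le> hit (- b) C" using hit_pos[OF C, of "- b"] by simp
qed

lemma hit_right_less:
  assumes b: "0 < b" and C: "F f 0 < C"
  shows "hit b C < sqrt (2 * (C - F f 0))"
proof (rule power_less_imp_less_base[of _ 2])
  have "F f 0 < F f (b * hit b C)" using b hit_pos[OF C, of b] by (intro F_strict_mono) simp
  then show "(hit b C)\<^sup>2 < (sqrt (2 * (C - F f 0)))\<^sup>2"
    using energy_at_hit[OF C, of b] C by simp
qed (use C in simp)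

definition arc_time_rate where
  "arc_time_rate k C = 1 / (slope k C * f (k * hit k C)) - integral {0..hit k C} (\<lambda>v. slowness_decay (C - v\<^sup>2 / 2))"

text \<open>The derivative of the arc time is split at height 0: the upper part gives the quarter-circle integral, the
  lower part the defect. Hence a decreasing arc time bounds the quarter-circle integral by \<open>V^2 * defect\<close>.\<close>

lemma arc_time_rate_left:
  assumes b: "0 < b" and C: "F f 0 < C"
  defines "V \<equiv> sqrt (2 * (C - F f 0))"
  shows "V\<^sup>2 * arc_time_rate (- b) C = quarter_circle_integral period_density V - V\<^sup>2 * defect b C"
proof -
  define n where "n = hit (- b) C"
  define s where "s = slope (- b) C"
  define f1 where "f1 = f (- b * n)"
  define k where "k = (\<lambda>v. slowness_decay (C - v\<^sup>2 / 2))"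
  have pos: "0 < n" "0 < s" "0 < f1" "0 < V" "0 < f 0"
    using hit_pos[OF C] slope_pos[OF C] f_pos C by (auto simp: n_def s_def f1_def V_def)
  have V2: "V\<^sup>2 = 2 * (C - F f 0)" using C by (simp add: V_def)
  have Vn: "V < n" using hit_left_gt[OF b C] by (simp add: V_def n_def)
  have kc: "continuous_on {0..n} k" unfolding k_def
    by (intro continuous_on_compose2[OF slowness_decay_cont] continuous_intros)
      (use energy_pos[OF C, of _ "- b"] in \<open>auto simp: n_def\<close>)
  have split: "integral {0..n} k = integral {0..V} k + integral {V..n} k"
    using Vn pos by (intro Henstock_Kurzweil_Integration.integral_combine[symmetric] integrable_continuous_real kc) auto
  have kV: "k = (\<lambda>v. slowness_decay (F f 0 + (V\<^sup>2 - v\<^sup>2) / 2))"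
    unfolding k_def V2 by (simp add: diff_divide_distrib)
  have Y: "quarter_circle_integral period_density V = V / f 0 - V\<^sup>2 * integral {0..V} k"
    using integral_period_density_tail[OF pos(4), of 0] unfolding quarter_circle_integral_def kV[symmetric] by simp
  have sn: "s = n - b * f1" by (simp add: s_def slope_def n_def f1_def)
  have "V\<^sup>2 * arc_time_rate (- b) C = V\<^sup>2 * (1 / (s * f1)) - V\<^sup>2 * integral {0..V} k - V\<^sup>2 * integral {V..n} k"
    unfolding arc_time_rate_def using split by (simp add: n_def[symmetric] s_def f1_def k_def algebra_simps)
  also have "integral {V..n} k = 1 / (f1 * n) - 1 / (f 0 * V) + left_int b C"
    using integral_slowness_decay_left[OF b C] by (simp add: n_def V_def f1_def k_def)
  also have "V\<^sup>2 * (1 / (s * f1)) - V\<^sup>2 * integral {0..V} k - V\<^sup>2 * (1 / (f1 * n) - 1 / (f 0 * V) + left_int b C)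
     = quarter_circle_integral period_density V + V\<^sup>2 * (1 / (s * f1) - 1 / (f1 * n)) - V\<^sup>2 * left_int b C"
  proof -
    have "V\<^sup>2 * (1 / (f 0 * V)) = V / f 0" using pos by (simp add: power2_eq_square)
    then show ?thesis unfolding Y by (simp add: algebra_simps)
  qed
  also have "1 / (s * f1) - 1 / (f1 * n) = b / (n * s)"
  proof -
    have "1 / (s * f1) - 1 / (f1 * n) = (n - s) / (n * s * f1)"
      using pos by (simp add: field_simps)
    also have "n - s = b * f1" by (simp add: sn)
    finally show ?thesis using pos by simp
  qed
  finally show ?thesis by (simp add: defect_def n_def s_def algebra_simps)
qed

lemma arc_time_has_deriv:
  "F f 0 < C \<Longrightarrow> (arc_time k has_real_derivative arc_time_rate k C) (at C)"
  unfolding arc_time_rate_def by (rule arc_time_deriv)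

text \<open>The heart of the argument. Monotonicity of the arc time at all levels \<open>x\<close> bounds the quarter-circle integrals
  of every radius, and the Abel bound converts this into a bound for the sector that the solution traverses at
  level \<open>C\<close>. The largest radius used is \<open>z2 < V\<close>, so that the strict growth of \<open>scaled_defect\<close> makes the result
  strict.\<close>

lemma transit_deriv_neg:
  assumes b: "0 < b" and C: "F f 0 < C"
    and decr: "\<And>x. F f 0 < x \<Longrightarrow> arc_time_rate (- b) x \<le> 0"
  shows "arc_time_rate (- b) C < arc_time_rate b C"
proof -
  define V where "V = sqrt (2 * (C - F f 0))"
  define w where "w = hit b C"
  define s where "s = slope b C"
  define u2 where "u2 = b * w"
  define f2 where "f2 = f u2"
  \<comment> \<open>The end point of the arc lies at the angle \<open>p\<close>, where \<open>z = z2\<close> and \<open>u = u2\<close>.\<close>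
  define p where "p = arccos (w / V)"
  define z2 where "z2 = V * sin p"
  define k where "k = (\<lambda>v. slowness_decay (C - v\<^sup>2 / 2))"
  have pos: "0 < w" "0 < s" "0 < f2" "0 < V"
    using hit_pos[OF C] slope_pos[OF C] f_pos C by (auto simp: w_def s_def f2_def V_def)
  have V2: "V\<^sup>2 = 2 * (C - F f 0)" using C by (simp add: V_def)
  have wV: "w < V" using hit_right_less[OF b C] by (simp add: V_def w_def)
  have q: "0 < w / V" "w / V < 1" using pos wV by auto
  have cp: "cos p = w / V" unfolding p_def using q by (intro cos_arccos) auto
  have p: "0 < p" "p < pi/2"
  proof -
    show "0 < p" unfolding p_def using arccos_lt_bounded[of "w / V"] q by auto
    show "p < pi/2" unfolding p_def using arccos_less_arccos[of 0 "w / V"] q by simp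
  qed
  have sp: "0 < sin p" "sin p < 1"
    using p sin_monotone_2pi[of p "pi/2"] by (auto intro: sin_gt_zero)
  have z2: "0 < z2" "z2 < V" using sp pos by (auto simp: z2_def)
  have z2sq: "z2\<^sup>2 = V\<^sup>2 - w\<^sup>2"
  proof -
    have "z2\<^sup>2 = V\<^sup>2 - (V * cos p)\<^sup>2" by (simp add: z2_def power_mult_distrib sin_squared_eq algebra_simps)
    then show ?thesis using pos by (simp add: cp)
  qed
  have level: "F f 0 + z2\<^sup>2 / 2 = F f u2"
    using energy_at_hit[OF C, of b] unfolding z2sq V2 by (simp add: u2_def w_def diff_divide_distrib)
  have kV: "k = (\<lambda>v. slowness_decay (F f 0 + (V\<^sup>2 - v\<^sup>2) / 2))"
    unfolding k_def V2 by (simp add: diff_divide_distrib)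
  have mean: "quarter_circle_integral period_density x \<le> scaled_defect b (F f 0 + x\<^sup>2 / 2) / x ^ 3" if "0 < x" for x
  proof -
    have lt: "F f 0 < F f 0 + x\<^sup>2 / 2" using that by simp
    have sq: "sqrt (2 * (F f 0 + x\<^sup>2 / 2 - F f 0)) = x" using that by simp
    have "quarter_circle_integral period_density x - x\<^sup>2 * defect b (F f 0 + x\<^sup>2 / 2) \<le> 0"
      using arc_time_rate_left[OF b lt] decr[OF lt] that unfolding sq
      by (metis mult_nonneg_nonpos zero_le_power2)
    moreover have "scaled_defect b (F f 0 + x\<^sup>2 / 2) = x ^ 5 * defect b (F f 0 + x\<^sup>2 / 2)"
      unfolding scaled_defect_def sq ..
    ultimately show ?thesis using that by (simp add: eval_nat_numeral power2_eq_square)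
  qed
  define A where "A = integral {0..p} (\<lambda>t. period_density (V * sin t) * (1 - cos p * cos t))"
  have "A \<le> scaled_defect b (F f u2) / V ^ 3"
    unfolding A_def
  proof (rule abel_bound[OF p, of "\<lambda>x. period_density (V * x)"])
    show "continuous_on {0..1} (\<lambda>x. period_density (V * x))"
      by (intro continuous_on_compose2[OF period_density_cont[of UNIV]] continuous_intros) auto
    fix x assume x: "0 < x" "x \<le> sin p"
    have "quarter_circle_integral (\<lambda>x. period_density (V * x)) x = quarter_circle_integral period_density (V * x)"
      by (simp add: quarter_circle_integral_def mult.assoc)
    also have "\<dots> \<le> scaled_defect b (F f 0 + (V * x)\<^sup>2 / 2) / (V * x) ^ 3"
      using x pos by (intro mean) simp
    also have "\<dots> \<le> scaled_defect b (F f u2) / (V * x) ^ 3"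
    proof (rule divide_right_mono)
      have "(V * x)\<^sup>2 \<le> z2\<^sup>2" unfolding z2_def using x pos by (intro power_mono mult_left_mono) auto
      then have le: "F f 0 + (V * x)\<^sup>2 / 2 \<le> F f u2" by (simp add: level[symmetric])
      have "F f 0 < F f 0 + (V * x)\<^sup>2 / 2" using x pos by simp
      from scaled_defect_strict_mono[OF b this, of "F f u2"] le
      show "scaled_defect b (F f 0 + (V * x)\<^sup>2 / 2) \<le> scaled_defect b (F f u2)" by (cases "F f 0 + (V * x)\<^sup>2 / 2 = F f u2") auto
    qed (use x pos in simp)
    also have "\<dots> = scaled_defect b (F f u2) / V ^ 3 / x ^ 3" by (simp add: power_mult_distrib)
    finally show "quarter_circle_integral (\<lambda>x. period_density (V * x)) x \<le> scaled_defect b (F f u2) / V ^ 3 / x ^ 3" .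
  qed
  also have "\<dots> < scaled_defect b C / V ^ 3"
  proof (rule divide_strict_right_mono)
    have "z2\<^sup>2 < V\<^sup>2" using z2 by (intro power_strict_mono) auto
    then have "F f u2 < C" using V2 by (simp add: level[symmetric])
    moreover have "F f 0 < F f u2" using z2 by (simp add: level[symmetric])
    ultimately show "scaled_defect b (F f u2) < scaled_defect b C" by (intro scaled_defect_strict_mono b)
  qed (use pos in simp)
  also have "scaled_defect b C / V ^ 3 = V\<^sup>2 * defect b C"
    unfolding scaled_defect_def V_def[symmetric] using pos by (simp add: eval_nat_numeral)
  finally have A: "A < V\<^sup>2 * defect b C" .
  \<comment> \<open>\<open>N\<close> is \<open>u - z u'(z)\<close> at the end of the sector; it measures how far \<open>w\<close> is from being proportional to \<open>V\<close>.\<close>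
  define N where "N = u2 - z2\<^sup>2 / f2"
  have cy: "continuous_on S (\<lambda>t. period_density (V * sin t))" for S
    by (intro continuous_on_compose2[OF period_density_cont[of UNIV]] continuous_intros) auto
  have c: "integral {0..p} (\<lambda>t. period_density (V * sin t) * cos t) = - N / V"
    using integral_period_density_cos[OF pos(4), of p] p unfolding z2_def[symmetric] level
    by (simp add: N_def f2_def)
  have "A = integral {0..p} (\<lambda>t. period_density (V * sin t) - cos p * (period_density (V * sin t) * cos t))"
    unfolding A_def by (simp add: algebra_simps)
  also have "\<dots> = integral {0..p} (\<lambda>t. period_density (V * sin t)) - cos p * integral {0..p} (\<lambda>t. period_density (V * sin t) * cos t)"
    unfolding integral_mult_right[symmetric]
    by (intro integral_diff integrable_continuous_real continuous_intros cy)
  finally have head: "integral {0..p} (\<lambda>t. period_density (V * sin t)) = A - w / V\<^sup>2 * N"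
    unfolding c cp by (simp add: power2_eq_square)
  have "quarter_circle_integral period_density V = integral {0..p} (\<lambda>t. period_density (V * sin t)) + integral {p..pi/2} (\<lambda>t. period_density (V * sin t))"
    unfolding quarter_circle_integral_def using p
    by (intro Henstock_Kurzweil_Integration.integral_combine[symmetric] integrable_continuous_real cy) auto
  moreover have "integral {p..pi/2} (\<lambda>t. period_density (V * sin t)) = w / f2 - V\<^sup>2 * integral {0..w} k"
    using integral_period_density_tail[OF pos(4), of p] p pos
    unfolding kV[symmetric] z2_def[symmetric] level by (simp add: cp f2_def)
  moreover have "V\<^sup>2 * arc_time_rate b C = V\<^sup>2 / (s * f2) - V\<^sup>2 * integral {0..w} k"
    unfolding arc_time_rate_def by (simp add: s_def w_def u2_def f2_def k_def algebra_simps)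
  moreover have "V\<^sup>2 * arc_time_rate (- b) C = quarter_circle_integral period_density V - V\<^sup>2 * defect b C"
    using arc_time_rate_left[OF b C] by (simp add: V_def)
  ultimately have "V\<^sup>2 * arc_time_rate (- b) C - V\<^sup>2 * arc_time_rate b C
      = (A - V\<^sup>2 * defect b C) + (w / f2 - V\<^sup>2 / (s * f2) - w / V\<^sup>2 * N)"
    using head by simp
  also have "w / f2 - V\<^sup>2 / (s * f2) - w / V\<^sup>2 * N = - (f2 / (s * V\<^sup>2) * N\<^sup>2)"
  proof -
    have sw: "s = w + b * f2" by (simp add: s_def slope_def w_def u2_def f2_def)
    \<comment> \<open>Both leftover terms are multiples of \<open>N\<close>, and the difference of their factors is again a multiple of \<open>N\<close>.\<close>
    have ws: "w * s = V\<^sup>2 + f2 * N"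
    proof -
      have "f2 * N = f2 * u2 - z2\<^sup>2" using pos by (simp add: N_def right_diff_distrib)
      then show ?thesis unfolding z2sq sw by (simp add: u2_def power2_eq_square algebra_simps)
    qed
    have "w / f2 - V\<^sup>2 / (s * f2) = (w * s - V\<^sup>2) / (s * f2)"
      using pos by (simp add: diff_divide_distrib)
    also have "\<dots> = N / s" unfolding ws using pos by simp
    finally have "w / f2 - V\<^sup>2 / (s * f2) - w / V\<^sup>2 * N = N * ((V\<^sup>2 - w * s) / (s * V\<^sup>2))"
      using pos by (simp add: diff_divide_distrib right_diff_distrib)
    also have "V\<^sup>2 - w * s = - (f2 * N)" using ws by simp
    finally show ?thesis by (simp add: power2_eq_square)
  qed
  also have "(A - V\<^sup>2 * defect b C) + - (f2 / (s * V\<^sup>2) * N\<^sup>2) < 0"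
  proof -
    have "0 \<le> f2 / (s * V\<^sup>2) * N\<^sup>2" using pos by (intro mult_nonneg_nonneg) auto
    with A show ?thesis by linarith
  qed
  finally have "V\<^sup>2 * arc_time_rate (- b) C < V\<^sup>2 * arc_time_rate b C" by simp
  then show ?thesis using pos by simp
qed

theorem transit_time_strict_decreasing:
  assumes b: "0 < b" and a: "strict_antimono_on {F f 0<..} (arc_time (- b))"
    and C: "F f 0 < C" "C < C'"
  shows "arc_time (- b) C' - arc_time b C' < arc_time (- b) C - arc_time b C"
proof -
  have decr: "arc_time_rate (- b) x \<le> 0" if x: "F f 0 < x" for x
  proof (rule ccontr)
    assume "\<not> ?thesis"
    then obtain d where d: "0 < d" "\<And>h. 0 < h \<Longrightarrow> h < d \<Longrightarrow> arc_time (- b) x < arc_time (- b) (x + h)"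
      using DERIV_pos_inc_right[OF arc_time_has_deriv[OF x, of "- b"]] by auto
    have "arc_time (- b) x < arc_time (- b) (x + d / 2)" using d by simp
    moreover have "arc_time (- b) (x + d / 2) < arc_time (- b) x"
      using a x d by (auto simp: monotone_on_def)
    ultimately show False by simp
  qed
  show ?thesis
  proof (rule DERIV_neg_imp_decreasing[OF C(2)])
    fix x assume "C \<le> x" "x \<le> C'"
    then have x: "F f 0 < x" using C by simp
    show "\<exists>D. ((\<lambda>C. arc_time (- b) C - arc_time b C) has_real_derivative D) (at x) \<and> D < 0"
      using DERIV_diff[OF arc_time_has_deriv[OF x, of "- b"] arc_time_has_deriv[OF x, of b]]
        transit_deriv_neg[OF b x decr] by force
  qed
qed

section \<open>From solutions to transit times\<close>

lemma arc_integrand_cont: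
  assumes "\<And>t. t \<in> S \<Longrightarrow> t\<^sup>2 < 2 * C"
  shows "continuous_on S (\<lambda>t. slowness (C - t\<^sup>2 / 2))"
proof (intro continuous_on_compose2[OF slowness_cont] continuous_intros)
  show "(\<lambda>t. C - t\<^sup>2 / 2) ` S \<subseteq> {0<..}"
  proof
    fix e assume "e \<in> (\<lambda>t. C - t\<^sup>2 / 2) ` S"
    then obtain t where "t \<in> S" "e = C - t\<^sup>2 / 2" by blast
    with assms[of t] show "e \<in> {0<..}" by simp
  qed
qed auto

lemma square_less_between:
  fixes s t x c :: real
  assumes "s\<^sup>2 < c" "t\<^sup>2 < c" "s \<le> x" "x \<le> t"
  shows "x\<^sup>2 < c"
proof -
  have "\<bar>x\<bar> \<le> max \<bar>s\<bar> \<bar>t\<bar>" using assms by linarith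
  then have "\<bar>x\<bar>\<^sup>2 \<le> (max \<bar>s\<bar> \<bar>t\<bar>)\<^sup>2" by (intro power_mono) auto
  also have "\<dots> < c" using assms by (simp add: max_def)
  finally show ?thesis by simp
qed

text \<open>Since \<open>v' = - sqrt lam / slowness (C - v^2/2)\<close>, the integral of the slowness from \<open>v L\<close> to \<open>v x\<close> decreases
  at the constant rate \<open>sqrt lam\<close>.\<close>

lemma time_along_trajectory:
  assumes L: "0 < L" and lam: "0 < lam"
    and cont: "continuous_on {0..L} u'"
    and ode: "\<forall>x\<in>{0<..<L}. \<exists>w. (u' has_real_derivative w) (at x) \<and> w + lam * f (u x) = 0"
    and on: "\<And>x. x \<in> {0..L} \<Longrightarrow> phase lam u u' x \<in> K f C"
    and x: "x \<in> {0..L}"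
  defines "v \<equiv> (\<lambda>x. u' x / sqrt lam)"
  shows "v L \<le> v x" "v x \<le> v 0" "u x = Finv f (C - (v x)\<^sup>2 / 2)"
    "integral {v L..v x} (\<lambda>t. slowness (C - t\<^sup>2 / 2)) = integral {v L..v 0} (\<lambda>t. slowness (C - t\<^sup>2 / 2)) - sqrt lam * x"
proof -
  let ?g = "\<lambda>t. slowness (C - t\<^sup>2 / 2)"
  have sl: "0 < sqrt lam" using lam by simp
  have K: "(v x)\<^sup>2 < 2 * C" "u x = Finv f (C - (v x)\<^sup>2 / 2)" if "x \<in> {0..L}" for x
  proof -
    show "(v x)\<^sup>2 < 2 * C" "u x = Finv f (C - (v x)\<^sup>2 / 2)"
      using on[OF that] by (simp_all add: phase_def K_def v_def)
  qed
  have cv: "continuous_on {0..L} v" unfolding v_def by (intro continuous_intros cont) (use lam in auto)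
  have dv: "(v has_real_derivative - sqrt lam / ?g (v x)) (at x)" if x: "x \<in> {0<..<L}" for x
  proof -
    obtain w where w: "(u' has_real_derivative w) (at x)" "w + lam * f (u x) = 0"
      using ode x by blast
    have "w / sqrt lam = - (lam / sqrt lam * f (u x))" using w(2) by (simp add: add_eq_0_iff)
    also have "lam / sqrt lam = sqrt lam" using lam by (simp add: real_div_sqrt)
    also have "- (sqrt lam * f (u x)) = - sqrt lam / ?g (v x)"
      using K(2)[of x] x by (simp add: slowness_def)
    finally show ?thesis using DERIV_cdivide[OF w(1), of "sqrt lam"] by (simp add: v_def)
  qed
  have neg: "- sqrt lam / ?g t < 0" for t using sl slowness_pos[of "C - t\<^sup>2 / 2"] by simp
  have decr: "v t < v s" if "0 \<le> s" "s < t" "t \<le> L" for s t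
  proof (rule DERIV_neg_imp_decreasing_open[OF that(2)])
    show "\<exists>D. (v has_real_derivative D) (at x) \<and> D < 0" if "s < x" "x < t" for x
    proof (intro exI conjI)
      show "(v has_real_derivative - sqrt lam / ?g (v x)) (at x)"
        using that \<open>0 \<le> s\<close> \<open>t \<le> L\<close> by (intro dv) simp
    qed (rule neg)
    show "continuous_on {s..t} v" by (rule continuous_on_subset[OF cv]) (use that in auto)
  qed
  have le: "v L \<le> v x" "v x \<le> v 0" if "x \<in> {0..L}" for x
  proof -
    show "v L \<le> v x" using decr[of x L] that by (cases "x = L") (simp_all add: less_imp_le)
    show "v x \<le> v 0" using decr[of 0 x] that by (cases "x = 0") (simp_all add: less_imp_le)
  qed
  show "v L \<le> v x" "v x \<le> v 0" "u x = Finv f (C - (v x)\<^sup>2 / 2)" using le x K(2) by auto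
  have cg: "continuous_on {v L..v 0} ?g"
  proof (rule arc_integrand_cont)
    fix t assume "t \<in> {v L..v 0}"
    then show "t\<^sup>2 < 2 * C"
      using square_less_between[of "v L" "2 * C" "v 0" t] K(1)[of L] K(1)[of 0] L by simp
  qed
  let ?R = "\<lambda>s. integral {v L..s} ?g"
  have cR: "continuous_on {v L..v 0} ?R"
    by (rule DERIV_continuous_on[where D="?g"]) (rule integral_has_real_derivative[OF cg])
  let ?h = "\<lambda>x. ?R (v x) + sqrt lam * x"
  have ch: "continuous_on {0..L} ?h"
    by (intro continuous_intros continuous_on_compose2[OF cR cv]) (use le in auto)
  have dh: "(?h has_real_derivative 0) (at x)" if x: "0 < x" "x < L" for x
  proof -
    have int: "v L < v x" "v x < v 0" using decr[of x L] decr[of 0 x] x by auto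
    then have "(?R has_real_derivative ?g (v x)) (at (v x))"
      using integral_has_real_derivative[OF cg, of "v x"] by (simp add: at_within_Icc_at)
    from DERIV_add[OF DERIV_chain2[OF this dv[of x]] DERIV_cmult_Id[of "sqrt lam"]] x
    have "(?h has_real_derivative ?g (v x) * (- sqrt lam / ?g (v x)) + sqrt lam) (at x)" by simp
    then show ?thesis using slowness_pos[of "C - (v x)\<^sup>2 / 2"] by simp
  qed
  have "?h x = ?h 0"
    by (rule DERIV_isconst2[OF L ch dh]) (use x in simp_all)
  then show "integral {v L..v x} ?g = integral {v L..v 0} ?g - sqrt lam * x" by simp
qed

text \<open>The time elapsed is a strictly monotone function of \<open>v\<close>, so it determines \<open>v\<close>, and the level then
  determines \<open>u\<close>.\<close>

lemma trajectory_unique: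
  assumes L: "0 < L" and lam: "0 < lam"
    and u: "continuous_on {0..L} u'"
      "\<forall>x\<in>{0<..<L}. \<exists>w. (u' has_real_derivative w) (at x) \<and> w + lam * f (u x) = 0"
      "\<And>x. x \<in> {0..L} \<Longrightarrow> phase lam u u' x \<in> K f C"
    and z: "continuous_on {0..L} z'"
      "\<forall>x\<in>{0<..<L}. \<exists>w. (z' has_real_derivative w) (at x) \<and> w + lam * f (z x) = 0"
      "\<And>x. x \<in> {0..L} \<Longrightarrow> phase lam z z' x \<in> K f C"
    and ends: "u' 0 = z' 0" "u' L = z' L" and x: "x \<in> {0..L}"
  shows "u x = z x"
proof -
  let ?g = "\<lambda>t. slowness (C - t\<^sup>2 / 2)"
  define v where "v = (\<lambda>x. u' x / sqrt lam)"
  define q where "q = (\<lambda>x. z' x / sqrt lam)"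
  have U: "v L \<le> v x" "v x \<le> v 0" "u x = Finv f (C - (v x)\<^sup>2 / 2)"
    "integral {v L..v x} ?g = integral {v L..v 0} ?g - sqrt lam * x"
    using time_along_trajectory[OF L lam u x] by (simp_all only: v_def)
  have Z: "q L \<le> q x" "q x \<le> q 0" "z x = Finv f (C - (q x)\<^sup>2 / 2)"
    "integral {q L..q x} ?g = integral {q L..q 0} ?g - sqrt lam * x"
    using time_along_trajectory[OF L lam z x] by (simp_all only: q_def)
  have e: "q L = v L" "q 0 = v 0" by (simp_all add: v_def q_def ends)
  have K: "(v L)\<^sup>2 < 2 * C" "(v 0)\<^sup>2 < 2 * C"
    using u(3)[of 0] u(3)[of L] L by (auto simp: phase_def K_def v_def)
  have eq: "integral {v L..v x} ?g = integral {v L..q x} ?g" using U(4) Z(4) by (simp add: e)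
  have strict: "integral {v L..s} ?g < integral {v L..t} ?g" if "v L \<le> s" "s < t" "t \<le> v 0" for s t
  proof -
    have cg: "continuous_on {v L..t} ?g"
    proof (rule arc_integrand_cont)
      fix x assume "x \<in> {v L..t}"
      then show "x\<^sup>2 < 2 * C" using square_less_between[OF K, of x] that by simp
    qed
    have "0 < integral {s..t} ?g"
      using integral_less_real[of s t "\<lambda>_. 0" ?g] that slowness_pos continuous_on_subset[OF cg, of "{s..t}"] by auto
    moreover have "integral {v L..s} ?g + integral {s..t} ?g = integral {v L..t} ?g"
      using that by (intro Henstock_Kurzweil_Integration.integral_combine integrable_continuous_real cg) auto
    ultimately show ?thesis by simp
  qed
  have "v x = q x"
    using strict[of "v x" "q x"] strict[of "q x" "v x"] eq U(1,2) Z(1,2) e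
    by (cases "v x" "q x" rule: linorder_cases) auto
  then show ?thesis using U(3) Z(3) by simp
qed

lemma transit_time_integral:
  assumes b: "0 < b" and C: "F f 0 < C"
  shows "integral {hit b C..hit (- b) C} (\<lambda>t. slowness (C - t\<^sup>2 / 2)) = arc_time (- b) C - arc_time b C"
    and "integral {- hit (- b) C..- hit b C} (\<lambda>t. slowness (C - t\<^sup>2 / 2)) = arc_time (- b) C - arc_time b C"
proof -
  let ?g = "\<lambda>t. slowness (C - t\<^sup>2 / 2)"
  have w: "0 < hit b C" "hit b C \<le> hit (- b) C"
    using hit_pos[OF C, of b] hit_right_less[OF b C] hit_left_gt[OF b C] by auto
  have "continuous_on {0..hit (- b) C} ?g"
    using energy_pos[OF C, of _ "- b"] by (intro arc_integrand_cont) force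
  then have "integral {0..hit b C} ?g + integral {hit b C..hit (- b) C} ?g = integral {0..hit (- b) C} ?g"
    using w by (intro Henstock_Kurzweil_Integration.integral_combine integrable_continuous_real) auto
  then show 1: "integral {hit b C..hit (- b) C} ?g = arc_time (- b) C - arc_time b C"
    by (simp add: arc_time_def)
  then show "integral {- hit (- b) C..- hit b C} ?g = arc_time (- b) C - arc_time b C"
    using Henstock_Kurzweil_Integration.integral_reflect_real[of "hit (- b) C" "hit b C" ?g] by simp
qed

text \<open>The negative abscissa on \<open>Lplus\<close> is reflected to the positive abscissa on the line of opposite slope.\<close>

lemma K_inter_Lplus:
  assumes b: "gamma_star \<alpha> lam = - b" and C: "F f 0 < C"
  shows "fst ` (K f C \<inter> Lplus \<alpha> lam) = {hit (- b) C, - hit b C}"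
proof -
  have mem: "v \<in> fst ` (K f C \<inter> Lplus \<alpha> lam) \<longleftrightarrow> ray (- b) v = C" for v
  proof -
    have "v \<in> fst ` (K f C \<inter> Lplus \<alpha> lam) \<longleftrightarrow> v\<^sup>2 < 2 * C \<and> Finv f (C - v\<^sup>2 / 2) = - b * v"
      by (force simp: K_def Lplus_def b image_iff)
    also have "\<dots> \<longleftrightarrow> ray (- b) v = C"
    proof
      assume "v\<^sup>2 < 2 * C \<and> Finv f (C - v\<^sup>2 / 2) = - b * v"
      then have "F f (- b * v) = C - v\<^sup>2 / 2" using F_Finv[of "C - v\<^sup>2 / 2"] by auto
      then show "ray (- b) v = C" by (simp add: ray_def)
    next
      assume "ray (- b) v = C"
      then have e: "C - v\<^sup>2 / 2 = F f (- b * v)" by (simp add: ray_def)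
      then have "v\<^sup>2 < 2 * C" using F_pos[of "- b * v"] by linarith
      then show "v\<^sup>2 < 2 * C \<and> Finv f (C - v\<^sup>2 / 2) = - b * v" by (simp add: e[simplified])
    qed
    finally show ?thesis .
  qed
  have "ray (- b) v = C \<longleftrightarrow> v = hit (- b) C \<or> v = - hit b C" for v
  proof (cases v "0::real" rule: linorder_cases)
    case less
    have "ray (- b) v = ray b (- v)" by (simp add: ray_def)
    then show ?thesis using less hit_eqI[OF C, of "- v" b] ray_hit[OF C, of b] hit_pos[OF C, of "- b"] by auto
  next
    case equal
    then show ?thesis using C hit_pos[OF C, of b] hit_pos[OF C, of "- b"] by (auto simp: ray_def)
  next
    case greater
    then show ?thesis using hit_eqI[OF C, of v "- b"] ray_hit[OF C, of "- b"] hit_pos[OF C, of b] by auto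
  qed
  with mem show ?thesis by blast
qed

lemma v1_v2_hit:
  assumes "gamma_star \<alpha> lam = - b" and "F f 0 < C"
  shows "v1 f \<alpha> lam C = hit (- b) C" "v2 f \<alpha> lam C = - hit b C"
  using K_inter_Lplus[OF assms] hit_pos[OF assms(2), of b] hit_pos[OF assms(2), of "- b"]
  by (simp_all add: v1_def v2_def)

lemma L1_arc_time:
  assumes "gamma_star \<alpha> lam = - b" and "F f 0 < C"
  shows "L1 f \<alpha> lam C = 2 / sqrt lam * arc_time (- b) C"
proof -
  have "integral {0..hit (- b) C} (\<lambda>v. 1 / (sqrt lam * f (Finv f (C - v\<^sup>2 / 2))))
      = integral {0..hit (- b) C} (\<lambda>v. 1 / sqrt lam * slowness (C - v\<^sup>2 / 2))"
    by (simp add: slowness_def)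
  then show ?thesis
    unfolding L1_def v1_v2_hit[OF assms] arc_time_def by (simp only: integral_mult_right)
qed

lemma increasing_solutionD:
  assumes g: "gamma_star \<alpha> lam = - b" and u: "u \<in> increasing_solutions f \<alpha> lam L"
  shows "\<exists>u' C. F f 0 < C \<and> bvp_solution f \<alpha> lam L u u' \<and> (\<forall>x\<in>{0..L}. phase lam u u' x \<in> K f C) \<and>
    u' 0 / sqrt lam = hit (- b) C \<and> u' L / sqrt lam = hit b C"
proof -
  obtain u' C where uC: "bvp_solution f \<alpha> lam L u u'" "F f 0 < C"
    and tr: "traverses_arc f C (P1plus f \<alpha> lam C) (P2minus f \<alpha> lam C) L (phase lam u u')"
    using u by (auto simp: increasing_solutions_def increasing_solution_def s0_def)
  have "phase lam u u' x \<in> K f C" if "x \<in> {0..L}" for x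
  proof -
    have "phase lam u u' x \<in> phase lam u u' ` {0..L}" using that by (rule imageI)
    then show ?thesis using tr by (auto simp: traverses_arc_def arc_of_K_def)
  qed
  moreover have "u' 0 / sqrt lam = hit (- b) C" "u' L / sqrt lam = hit b C"
    using tr by (simp_all add: traverses_arc_def phase_def P1plus_def P2minus_def v1_v2_hit[OF g uC(2)])
  ultimately show ?thesis using uC by blast
qed

lemma decreasing_solutionD:
  assumes g: "gamma_star \<alpha> lam = - b" and u: "u \<in> decreasing_solutions f \<alpha> lam L"
  shows "\<exists>u' C. F f 0 < C \<and> bvp_solution f \<alpha> lam L u u' \<and> (\<forall>x\<in>{0..L}. phase lam u u' x \<in> K f C) \<and>
    u' 0 / sqrt lam = - hit b C \<and> u' L / sqrt lam = - hit (- b) C"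
proof -
  obtain u' C where uC: "bvp_solution f \<alpha> lam L u u'" "F f 0 < C"
    and tr: "traverses_arc f C (P2plus f \<alpha> lam C) (P1minus f \<alpha> lam C) L (phase lam u u')"
    using u by (auto simp: decreasing_solutions_def decreasing_solution_def s0_def)
  have "phase lam u u' x \<in> K f C" if "x \<in> {0..L}" for x
  proof -
    have "phase lam u u' x \<in> phase lam u u' ` {0..L}" using that by (rule imageI)
    then show ?thesis using tr by (auto simp: traverses_arc_def arc_of_K_def)
  qed
  moreover have "u' 0 / sqrt lam = - hit b C" "u' L / sqrt lam = - hit (- b) C"
    using tr by (simp_all add: traverses_arc_def phase_def P2plus_def P1minus_def v1_v2_hit[OF g uC(2)])
  ultimately show ?thesis using uC by blast
qed

end

theorem theorem3p21:
  fixes f f' f'' :: "real \<Rightarrow> real" and \<alpha> lam L :: real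
  assumes "\<alpha> < 0" and "lam > 0"
    and "\<And>t. (f has_real_derivative f' t) (at t)"
    and "\<And>t. (f' has_real_derivative f'' t) (at t)"
    and "continuous_on UNIV f''"
    and "\<And>t. f t > 0" and "\<And>t. f' t \<ge> 0" and "\<And>t. f'' t > 0"
    and "filterlim (\<lambda>t. f t / t) at_top at_top"
    and "f integrable_on {..0}"
    and "strict_antimono_on {s0 f<..} (L1 f \<alpha> lam)"
    and "L > 0"
  shows "finite (increasing_solutions f \<alpha> lam L) \<and> card (increasing_solutions f \<alpha> lam L) \<le> 2 \<and>
         finite (decreasing_solutions f \<alpha> lam L) \<and> card (decreasing_solutions f \<alpha> lam L) \<le> 2"
proof -
  interpret oscillator f f'
  proof
    show "continuous_on UNIV f'"
      by (rule DERIV_continuous_on[where D=f'']) (rule assms(4))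
    fix t
    have "f' (t - 1) < f' t"
      by (rule DERIV_pos_imp_increasing) (use assms(4,8) in auto)
    then show "0 < f' t" using assms(7)[of "t - 1"] by simp
  qed (use assms in auto)
  define b where "b = - gamma_star \<alpha> lam"
  have b: "0 < b" and g: "gamma_star \<alpha> lam = - b"
    using assms(1,2) by (auto simp: b_def gamma_star_def divide_less_0_iff)
  have sl: "0 < sqrt lam" using assms(2) by simp
  have "strict_antimono_on {F f 0<..} (arc_time (- b))"
  proof (rule monotone_onI)
    fix x z assume xz: "x \<in> {F f 0<..}" "z \<in> {F f 0<..}" "x < z"
    then have "L1 f \<alpha> lam z < L1 f \<alpha> lam x"
      using monotone_onD[OF assms(11)] by (simp add: s0_def)
    then show "arc_time (- b) z < arc_time (- b) x"
      using xz sl by (simp add: L1_arc_time[OF g] divide_strict_right_mono divide_less_cancel)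
  qed
  note T = transit_time_strict_decreasing[OF b this]
  have same_C: "C = D"
    if "F f 0 < C" "F f 0 < D" "arc_time (- b) C - arc_time b C = arc_time (- b) D - arc_time b D" for C D
    using that T[of C D] T[of D C] by (cases C D rule: linorder_cases) auto
  have unique: "u = z"
    if ext: "u \<in> extensional {0..L}" "z \<in> extensional {0..L}"
    and sol: "bvp_solution f \<alpha> lam L u u'" "bvp_solution f \<alpha> lam L z z'"
    and CD: "F f 0 < C" "F f 0 < D"
    and arcs: "\<And>x. x \<in> {0..L} \<Longrightarrow> phase lam u u' x \<in> K f C" "\<And>x. x \<in> {0..L} \<Longrightarrow> phase lam z z' x \<in> K f D"
    and ends: "u' 0 / sqrt lam = A C" "u' L / sqrt lam = B C" "z' 0 / sqrt lam = A D" "z' L / sqrt lam = B D"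
    and time: "\<And>x. F f 0 < x \<Longrightarrow> integral {B x..A x} (\<lambda>t. slowness (x - t\<^sup>2 / 2)) = arc_time (- b) x - arc_time b x"
    for u u' z z' C D A B
  proof -
    have u: "continuous_on {0..L} u'"
      "\<forall>x\<in>{0<..<L}. \<exists>w. (u' has_real_derivative w) (at x) \<and> w + lam * f (u x) = 0"
      and z: "continuous_on {0..L} z'"
      "\<forall>x\<in>{0<..<L}. \<exists>w. (z' has_real_derivative w) (at x) \<and> w + lam * f (z x) = 0"
      using sol by (auto simp: bvp_solution_def)
    have LL: "L \<in> {0..L}" using assms(12) by simp
    have "arc_time (- b) C - arc_time b C = sqrt lam * L"
      using time_along_trajectory(4)[OF assms(12,2) u arcs(1) LL] time[OF CD(1)] by (simp add: ends)
    moreover have "arc_time (- b) D - arc_time b D = sqrt lam * L"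
      using time_along_trajectory(4)[OF assms(12,2) z arcs(2) LL] time[OF CD(2)] by (simp add: ends)
    ultimately have D: "D = C" using same_C CD by simp
    have e: "u' 0 = z' 0" "u' L = z' L" using ends sl by (auto simp: D field_simps)
    show "u = z"
      by (rule extensionalityI[OF ext]) (rule trajectory_unique[OF assms(12,2) u arcs(1) z arcs(2)[unfolded D] e])
  qed
  have inc: "u = z" if uz: "u \<in> increasing_solutions f \<alpha> lam L" "z \<in> increasing_solutions f \<alpha> lam L" for u z
  proof -
    have ext: "u \<in> extensional {0..L}" "z \<in> extensional {0..L}"
      using uz by (auto simp: increasing_solutions_def)
    obtain u' C where u: "F f 0 < C" "bvp_solution f \<alpha> lam L u u'"
      "\<And>x. x \<in> {0..L} \<Longrightarrow> phase lam u u' x \<in> K f C" "u' 0 / sqrt lam = hit (- b) C" "u' L / sqrt lam = hit b C"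
      using increasing_solutionD[OF g uz(1)] by blast
    obtain z' D where z: "F f 0 < D" "bvp_solution f \<alpha> lam L z z'"
      "\<And>x. x \<in> {0..L} \<Longrightarrow> phase lam z z' x \<in> K f D" "z' 0 / sqrt lam = hit (- b) D" "z' L / sqrt lam = hit b D"
      using increasing_solutionD[OF g uz(2)] by blast
    show ?thesis
      by (rule unique[where A="hit (- b)" and B="hit b", OF ext u(2) z(2) u(1) z(1) u(3) z(3) u(4,5) z(4,5)
            transit_time_integral(1)[OF b]])
  qed
  have dec: "u = z" if uz: "u \<in> decreasing_solutions f \<alpha> lam L" "z \<in> decreasing_solutions f \<alpha> lam L" for u z
  proof -
    have ext: "u \<in> extensional {0..L}" "z \<in> extensional {0..L}"
      using uz by (auto simp: decreasing_solutions_def)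
    obtain u' C where u: "F f 0 < C" "bvp_solution f \<alpha> lam L u u'"
      "\<And>x. x \<in> {0..L} \<Longrightarrow> phase lam u u' x \<in> K f C" "u' 0 / sqrt lam = - hit b C" "u' L / sqrt lam = - hit (- b) C"
      using decreasing_solutionD[OF g uz(1)] by blast
    obtain z' D where z: "F f 0 < D" "bvp_solution f \<alpha> lam L z z'"
      "\<And>x. x \<in> {0..L} \<Longrightarrow> phase lam z z' x \<in> K f D" "z' 0 / sqrt lam = - hit b D" "z' L / sqrt lam = - hit (- b) D"
      using decreasing_solutionD[OF g uz(2)] by blast
    show ?thesis
      by (rule unique[where A="\<lambda>C. - hit b C" and B="\<lambda>C. - hit (- b) C", OF ext u(2) z(2) u(1) z(1) u(3) z(3) u(4,5) z(4,5)
            transit_time_integral(2)[OF b]])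
  qed
  have few: "finite S \<and> card S \<le> 2" if "\<And>u z. u \<in> S \<Longrightarrow> z \<in> S \<Longrightarrow> u = z" for S :: "(real \<Rightarrow> real) set"
  proof (cases "S = {}")
    case False
    then obtain u where "u \<in> S" by blast
    with that have "S = {u}" by blast
    then show ?thesis by simp
  qed simp
  show ?thesis using few[OF inc] few[OF dec] by simp
qed

end
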